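(* Let $\mathcal{D}$ be a triangulated category with shift $\Sigma$, and let $\mathbf{t}_1\le\mathbf{t}_2\le\mathbf{t}_3$ be $s$-torsion pairs in $\mathcal{D}$ such that $\mathbf{t}_1\le\Sigma\mathbf{t}_2$ and $\mathbf{t}_3=\Sigma^{-1}\mathbf{t}_2$. Then, for $V\in\mathcal{H}_{[\mathbf{t}_1,\mathbf{t}_3]}$, the following statements are equivalent. (a) $V$ is an extended tilting object in $\mathcal{H}_{[\mathbf{t}_1,\mathbf{t}_3]}$. (b) $V$ is an extended tilting object in $\mathcal{H}_{[\mathbf{t}_1,\mathbf{t}_3]}$ such that $\mathrm{Gen}_{\mathcal{H}_{[\mathbf{t}_1,\mathbf{t}_3]}}(V)=V^{\perp_1}_{\mathcal{H}_{[\mathbf{t}_1,\mathbf{t}_3]}}$. (c) $\mathcal{H}_{[\mathbf{t}_1,\mathbf{t}_2]}$ is a cogenerating class in $\mathcal{H}_{[\mathbf{t}_1,\mathbf{t}_3]}$ and $V$ is a projective generator in $\mathcal{H}_{[\mathbf{t}_1,\mathbf{t}_2]}$. Moreover, in case any of these statements is satisfied, $\mathbf{t}_1=\Sigma\mathbf{t}_2$.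
   Context: Let $\mathcal{D}$ be a triangulated category with shift automorphism $\Sigma$. A full extension-closed subcategory $\mathcal{X}\subseteq\mathcal{D}$ (in particular $\mathcal{D}$ itself) is regarded as an extriangulated category with negative first extension: its $\mathfrak{s}$-conflations are the sequences $A\to B\to C$ with $A,B,C\in\mathcal{X}$ that are part of a distinguished triangle $A\to B\to C\to\Sigma A$; $\mathbb{E}(X,Y)=\mathbb{E}^1(X,Y)=\mathrm{Hom}_{\mathcal{D}}(X,\Sigma Y)$, $\mathbb{E}^0=\mathrm{Hom}_{\mathcal{D}}$ and $\mathbb{E}^{-1}(X,Y)=\mathrm{Hom}_{\mathcal{D}}(X,\Sigma^{-1}Y)$. For classes $\mathcal{A},\mathcal{B}$, $\mathcal{A}\star\mathcal{B}$ is the class of objects $C$ admitting an $\mathfrak{s}$-conflation $A\to C\to B$ with $A\in\mathcal{A}$, $B\in\mathcal{B}$. An $s$-torsion pair in $\mathcal{X}$ is a pair $\mathbf{t}=(\mathcal{T},\mathcal{F})$ of full isomorphism-closed subcategories of $\mathcal{X}$ with $\mathrm{Hom}(\mathcal{T},\mathcal{F})=0$, $\mathbb{E}^{-1}(\mathcal{T},\mathcal{F})=0$ and $\mathcal{X}=\mathcal{T}\star\mathcal{F}$ (conflations taken in $\mathcal{X}$). The poset of them is $\mathsf{stors}\,\mathcal{X}$, ordered by $(\mathcal{T},\mathcal{F})\le(\mathcal{T}',\mathcal{F}')$ iff $\mathcal{T}\subseteq\mathcal{T}'$. For $\mathbf{t}=(\mathcal{T},\mathcal{F})\in\mathsf{stors}\,\mathcal{D}$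 and $k\in\mathbb{Z}$, $\Sigma^{k}\mathbf{t}=(\Sigma^k\mathcal{T},\Sigma^k\mathcal{F})\in\mathsf{stors}\,\mathcal{D}$. For $\mathbf{t}_1=(\mathcal{T}_1,\mathcal{F}_1)\le\mathbf{t}_2=(\mathcal{T}_2,\mathcal{F}_2)$ in $\mathsf{stors}\,\mathcal{D}$, the heart of the interval $[\mathbf{t}_1,\mathbf{t}_2]$ is the extension-closed subcategory $\mathcal{H}_{[\mathbf{t}_1,\mathbf{t}_2]}=\mathcal{F}_1\cap\mathcal{T}_2$. Let $\mathcal{X}$ be an extriangulated category with negative first extension and $V\in\mathcal{X}$. - $V^{\perp_i}=V^{\perp_i}_{\mathcal{X}}=\{X\in\mathcal{X}:\mathbb{E}^i(V,X)=0\}$ for $i\in\{-1,0,1\}$. - $\mathrm{Gen}(V)=\mathrm{Gen}_{\mathcal{X}}(V)$ is the class of $X\in\mathcal{X}$ such that $X=0$ or there is an $\mathfrak{s}$-conflation $A\to\coprod_\alpha V\xrightarrow{f}X$ in $\mathcal{X}$ for some set $\alpha$ (for which the coproduct exists in $\mathcal{X}$) with $f\ne0$. - $\mathrm{Pres}(V)=\mathrm{Pres}_{\mathcal{X}}(V)$ is the class of $X\in\mathcal{X}$ such that $X=0$ or there is such a conflation with moreover $A\in\mathrm{Gen}(V)$. - $V$ is a generator in $\mathcal{X}$ if $\mathrm{Gen}_{\mathcal{X}}(V)=\mathcal{X}$; it is projective in $\mathcal{X}$ if $\mathbb{E}(V,X)=0$ for all $X\in\mathcal{X}$; a projective generator is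 an object that is both. - A class $\mathcal{S}\subseteq\mathcal{X}$ is cogenerating in $\mathcal{X}$ if every $X\in\mathcal{X}$ admits an $\mathfrak{s}$-conflation $X\to S\to X'$ in $\mathcal{X}$ with $S\in\mathcal{S}$. - $V$ is extended tilting in $\mathcal{X}$ if (T1) $(\mathrm{Gen}(V),V^{\perp_0})\in\mathsf{stors}\,\mathcal{X}$; (T2) $\mathrm{Gen}(V)=\mathrm{Pres}(V)$ and $\mathrm{Gen}(V)\subseteq V^{\perp_1}$; (T3) $\mathrm{Gen}(V)$ is a cogenerating class in $\mathcal{X}$.
   Formalization: The formal theorem additionally assumes that V is nonzero unless the heart of [t₁,t₃] is zero; otherwise V = 0 with t₁ = (0,D), t₂ = t₃ = (D,0), D ≠ 0 satisfies (a) but not (b), (c) or t₁ = Σt₂. *)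

theory Defs
  imports "HOL-Algebra.Group"
begin

section \<open>Categories\<close>

record ('o, 'm) category_data =
  Obj :: "'o set"
  Arr :: "'m set"
  Dom :: "'m \<Rightarrow> 'o"
  Cod :: "'m \<Rightarrow> 'o"
  Id :: "'o \<Rightarrow> 'm"
  Comp :: "'m \<Rightarrow> 'm \<Rightarrow> 'm"  (infixl "\<cdot>\<index>" 70)

definition Hom :: "('o, 'm, 'x) category_data_scheme \<Rightarrow> 'o \<Rightarrow> 'o \<Rightarrow> 'm set" where
  "Hom D A B = {f \<in> Arr D. Dom D f = A \<and> Cod D f = B}"

text \<open>\<open>g \<cdot> f\<close> is the composite of \<open>f\<close> followed by \<open>g\<close>.\<close>

locale category =
  fixes D :: "('o, 'm, 'x) category_data_scheme" (structure)
  assumes Dom_Obj: "f \<in> Arr D \<Longrightarrow> Dom D f \<in> Obj D"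
    and Cod_Obj: "f \<in> Arr D \<Longrightarrow> Cod D f \<in> Obj D"
    and Id_Hom: "A \<in> Obj D \<Longrightarrow> Id D A \<in> Hom D A A"
    and Comp_Hom: "\<lbrakk>f \<in> Hom D A B; g \<in> Hom D B C\<rbrakk> \<Longrightarrow> g \<cdot> f \<in> Hom D A C"
    and Comp_Id: "f \<in> Hom D A B \<Longrightarrow> f \<cdot> Id D A = f"
    and Id_Comp: "f \<in> Hom D A B \<Longrightarrow> Id D B \<cdot> f = f"
    and Comp_assoc: "\<lbrakk>f \<in> Hom D A B; g \<in> Hom D B C; h \<in> Hom D C E\<rbrakk>
      \<Longrightarrow> h \<cdot> (g \<cdot> f) = (h \<cdot> g) \<cdot> f"

definition iso_arr :: "('o, 'm, 'x) category_data_scheme \<Rightarrow> 'm \<Rightarrow> bool" where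
  "iso_arr D f \<longleftrightarrow> f \<in> Arr D \<and>
    (\<exists>g \<in> Hom D (Cod D f) (Dom D f).
      g \<cdot>\<^bsub>D\<^esub> f = Id D (Dom D f) \<and> f \<cdot>\<^bsub>D\<^esub> g = Id D (Cod D f))"

definition isomorphic :: "('o, 'm, 'x) category_data_scheme \<Rightarrow> 'o \<Rightarrow> 'o \<Rightarrow> bool" where
  "isomorphic D A B \<longleftrightarrow> (\<exists>f \<in> Hom D A B. iso_arr D f)"

definition zero_object :: "('o, 'm, 'x) category_data_scheme \<Rightarrow> 'o \<Rightarrow> bool" where
  "zero_object D Z \<longleftrightarrow> Z \<in> Obj D \<and>
    (\<forall>A \<in> Obj D. (\<exists>!f. f \<in> Hom D A Z) \<and> (\<exists>!f. f \<in> Hom D Z A))"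

text \<open>\<open>P\<close> with injections \<open>\<iota> i\<close> is the coproduct of the family \<open>(M i)\<^sub>i\<^sub>\<in>\<^sub>I\<close> in the full subcategory
  on the class of objects \<open>X\<close>: both \<open>P\<close> and the test objects lie in \<open>X\<close>.\<close>

definition is_coproduct ::
    "('o, 'm, 'x) category_data_scheme \<Rightarrow> 'o set \<Rightarrow> 'i set \<Rightarrow> ('i \<Rightarrow> 'o) \<Rightarrow> 'o \<Rightarrow> ('i \<Rightarrow> 'm) \<Rightarrow> bool" where
  "is_coproduct D X I M P \<iota> \<longleftrightarrow>
    P \<in> X \<and> (\<forall>i \<in> I. \<iota> i \<in> Hom D (M i) P) \<and>
    (\<forall>Y \<in> X. \<forall>\<phi>. (\<forall>i \<in> I. \<phi> i \<in> Hom D (M i) Y) \<longrightarrow>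
      (\<exists>!u. u \<in> Hom D P Y \<and> (\<forall>i \<in> I. u \<cdot>\<^bsub>D\<^esub> \<iota> i = \<phi> i)))"


section \<open>Additive categories\<close>

record ('o, 'm) additive_data = "('o, 'm) category_data" +
  Add :: "'m \<Rightarrow> 'm \<Rightarrow> 'm"
  Zero :: "'o \<Rightarrow> 'o \<Rightarrow> 'm"

definition Hom_group :: "('o, 'm, 'x) additive_data_scheme \<Rightarrow> 'o \<Rightarrow> 'o \<Rightarrow> 'm monoid" where
  "Hom_group D A B = \<lparr>carrier = Hom D A B, monoid.mult = Add D, one = Zero D A B\<rparr>"

definition Neg :: "('o, 'm, 'x) additive_data_scheme \<Rightarrow> 'm \<Rightarrow> 'm" where
  "Neg D f = inv\<^bsub>Hom_group D (Dom D f) (Cod D f)\<^esub> f"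

definition is_biproduct ::
    "('o, 'm, 'x) additive_data_scheme \<Rightarrow> 'o \<Rightarrow> 'o \<Rightarrow> 'o \<Rightarrow> 'm \<Rightarrow> 'm \<Rightarrow> 'm \<Rightarrow> 'm \<Rightarrow> bool" where
  "is_biproduct D A B P i\<^sub>A i\<^sub>B p\<^sub>A p\<^sub>B \<longleftrightarrow>
    i\<^sub>A \<in> Hom D A P \<and> i\<^sub>B \<in> Hom D B P \<and> p\<^sub>A \<in> Hom D P A \<and> p\<^sub>B \<in> Hom D P B \<and>
    p\<^sub>A \<cdot>\<^bsub>D\<^esub> i\<^sub>A = Id D A \<and> p\<^sub>B \<cdot>\<^bsub>D\<^esub> i\<^sub>B = Id D B \<and>
    p\<^sub>A \<cdot>\<^bsub>D\<^esub> i\<^sub>B = Zero D B A \<and> p\<^sub>B \<cdot>\<^bsub>D\<^esub> i\<^sub>A = Zero D A B \<and>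
    Add D (i\<^sub>A \<cdot>\<^bsub>D\<^esub> p\<^sub>A) (i\<^sub>B \<cdot>\<^bsub>D\<^esub> p\<^sub>B) = Id D P"

locale additive_category = category D
  for D :: "('o, 'm, 'x) additive_data_scheme" (structure) +
  assumes Hom_comm_group: "\<lbrakk>A \<in> Obj D; B \<in> Obj D\<rbrakk> \<Longrightarrow> comm_group (Hom_group D A B)"
    and Comp_Add: "\<lbrakk>f \<in> Hom D A B; f' \<in> Hom D A B; g \<in> Hom D B C\<rbrakk>
      \<Longrightarrow> g \<cdot> Add D f f' = Add D (g \<cdot> f) (g \<cdot> f')"
    and Add_Comp: "\<lbrakk>f \<in> Hom D A B; g \<in> Hom D B C; g' \<in> Hom D B C\<rbrakk>
      \<Longrightarrow> Add D g g' \<cdot> f = Add D (g \<cdot> f) (g' \<cdot> f)"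
    and ex_zero_object: "\<exists>Z. zero_object D Z"
    and ex_biproduct: "\<lbrakk>A \<in> Obj D; B \<in> Obj D\<rbrakk>
      \<Longrightarrow> \<exists>P \<in> Obj D. \<exists>i\<^sub>A i\<^sub>B p\<^sub>A p\<^sub>B. is_biproduct D A B P i\<^sub>A i\<^sub>B p\<^sub>A p\<^sub>B"


section \<open>Triangulated categories\<close>

text \<open>\<open>SO\<close> and \<open>SA\<close> are the actions of \<open>\<Sigma>\<close> on objects and arrows. An element \<open>(f, g, h)\<close> of
  \<open>Dist\<close> is a distinguished triangle \<open>A \<rightarrow> B \<rightarrow> C \<rightarrow> \<Sigma>A\<close>; its vertices are recovered from the
  arrows.\<close>

record ('o, 'm) triangulated_data = "('o, 'm) additive_data" +
  SO :: "'o \<Rightarrow> 'o"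
  SA :: "'m \<Rightarrow> 'm"
  Dist :: "('m \<times> 'm \<times> 'm) set"

locale triangulated_category = additive_category D
  for D :: "('o, 'm, 'x) triangulated_data_scheme" (structure) +
  assumes SO_bij: "bij_betw (SO D) (Obj D) (Obj D)"
    and SA_bij: "bij_betw (SA D) (Arr D) (Arr D)"
    and SA_Hom: "f \<in> Hom D A B \<Longrightarrow> SA D f \<in> Hom D (SO D A) (SO D B)"
    and SA_Id: "A \<in> Obj D \<Longrightarrow> SA D (Id D A) = Id D (SO D A)"
    and SA_Comp: "\<lbrakk>f \<in> Hom D A B; g \<in> Hom D B C\<rbrakk> \<Longrightarrow> SA D (g \<cdot> f) = SA D g \<cdot> SA D f"
    and SA_Add: "\<lbrakk>f \<in> Hom D A B; f' \<in> Hom D A B\<rbrakk>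
      \<Longrightarrow> SA D (Add D f f') = Add D (SA D f) (SA D f')"
    and Dist_Hom: "(f, g, h) \<in> Dist D
      \<Longrightarrow> \<exists>A B C. f \<in> Hom D A B \<and> g \<in> Hom D B C \<and> h \<in> Hom D C (SO D A)"
    and TR1_iso: "\<lbrakk>(f, g, h) \<in> Dist D;
        f \<in> Hom D A B; g \<in> Hom D B C; h \<in> Hom D C (SO D A);
        f' \<in> Hom D A' B'; g' \<in> Hom D B' C'; h' \<in> Hom D C' (SO D A');
        a \<in> Hom D A A'; b \<in> Hom D B B'; c \<in> Hom D C C';
        iso_arr D a; iso_arr D b; iso_arr D c;
        b \<cdot> f = f' \<cdot> a; c \<cdot> g = g' \<cdot> b; SA D a \<cdot> h = h' \<cdot> c\<rbrakk>
      \<Longrightarrow> (f', g', h') \<in> Dist D"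
    and TR1_Id: "\<lbrakk>A \<in> Obj D; zero_object D Z\<rbrakk>
      \<Longrightarrow> (Id D A, Zero D A Z, Zero D Z (SO D A)) \<in> Dist D"
    and TR1_cone: "f \<in> Arr D \<Longrightarrow> \<exists>g h. (f, g, h) \<in> Dist D"
    and TR2: "\<lbrakk>f \<in> Hom D A B; g \<in> Hom D B C; h \<in> Hom D C (SO D A)\<rbrakk>
      \<Longrightarrow> (f, g, h) \<in> Dist D \<longleftrightarrow> (g, h, Neg D (SA D f)) \<in> Dist D"
    and TR3: "\<lbrakk>(f, g, h) \<in> Dist D; (f', g', h') \<in> Dist D;
        f \<in> Hom D A B; g \<in> Hom D B C; h \<in> Hom D C (SO D A);
        f' \<in> Hom D A' B'; g' \<in> Hom D B' C'; h' \<in> Hom D C' (SO D A');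
        a \<in> Hom D A A'; b \<in> Hom D B B'; b \<cdot> f = f' \<cdot> a\<rbrakk>
      \<Longrightarrow> \<exists>c \<in> Hom D C C'. c \<cdot> g = g' \<cdot> b \<and> SA D a \<cdot> h = h' \<cdot> c"
    and TR4: "\<lbrakk>f \<in> Hom D A B; g \<in> Hom D B C;
        (f, f', f'') \<in> Dist D; f' \<in> Hom D B U; f'' \<in> Hom D U (SO D A);
        (g, g', g'') \<in> Dist D; g' \<in> Hom D C W; g'' \<in> Hom D W (SO D B);
        (g \<cdot> f, k', k'') \<in> Dist D; k' \<in> Hom D C V; k'' \<in> Hom D V (SO D A)\<rbrakk>
      \<Longrightarrow> \<exists>u \<in> Hom D U V. \<exists>v \<in> Hom D V W. (u, v, SA D f' \<cdot> g'') \<in> Dist D \<and>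
            u \<cdot> f' = k' \<cdot> g \<and> k'' \<cdot> u = f'' \<and> v \<cdot> k' = g' \<and> g'' \<cdot> v = SA D f \<cdot> k''"

definition shift :: "('o, 'm, 'x) triangulated_data_scheme \<Rightarrow> int \<Rightarrow> 'o \<Rightarrow> 'o" where
  "shift D k A = (if 0 \<le> k then (SO D ^^ nat k) A
                  else (inv_into (Obj D) (SO D) ^^ nat (- k)) A)"

definition Ext :: "('o, 'm, 'x) triangulated_data_scheme \<Rightarrow> int \<Rightarrow> 'o \<Rightarrow> 'o \<Rightarrow> 'm set" where
  "Ext D i A B = Hom D A (shift D i B)"

definition Ext_vanishes :: "('o, 'm, 'x) triangulated_data_scheme \<Rightarrow> int \<Rightarrow> 'o \<Rightarrow> 'o \<Rightarrow> bool" where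
  "Ext_vanishes D i A B \<longleftrightarrow> Ext D i A B = {Zero D A (shift D i B)}"


section \<open>Extension-closed subcategories as extriangulated categories\<close>

text \<open>Full subcategories are represented by their classes of objects, always called \<open>X\<close> below.\<close>

definition conflation ::
    "('o, 'm, 'x) triangulated_data_scheme \<Rightarrow> 'o set \<Rightarrow> 'o \<Rightarrow> 'm \<Rightarrow> 'o \<Rightarrow> 'm \<Rightarrow> 'o \<Rightarrow> bool" where
  "conflation D X A f B g C \<longleftrightarrow>
    A \<in> X \<and> B \<in> X \<and> C \<in> X \<and> f \<in> Hom D A B \<and> g \<in> Hom D B C \<and>
    (\<exists>h \<in> Hom D C (SO D A). (f, g, h) \<in> Dist D)"

definition star ::
    "('o, 'm, 'x) triangulated_data_scheme \<Rightarrow> 'o set \<Rightarrow> 'o set \<Rightarrow> 'o set \<Rightarrow> 'o set" where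
  "star D X \<A> \<B> = {C. \<exists>A \<in> \<A>. \<exists>B \<in> \<B>. \<exists>f g. conflation D X A f C g B}"

definition iso_closed_in :: "('o, 'm, 'x) category_data_scheme \<Rightarrow> 'o set \<Rightarrow> 'o set \<Rightarrow> bool" where
  "iso_closed_in D X S \<longleftrightarrow> S \<subseteq> X \<and> (\<forall>A \<in> S. \<forall>B \<in> X. isomorphic D A B \<longrightarrow> B \<in> S)"

definition stors ::
    "('o, 'm, 'x) triangulated_data_scheme \<Rightarrow> 'o set \<Rightarrow> ('o set \<times> 'o set) set" where
  "stors D X = {(T, F). iso_closed_in D X T \<and> iso_closed_in D X F \<and>
    (\<forall>A \<in> T. \<forall>B \<in> F. Ext_vanishes D 0 A B) \<and>
    (\<forall>A \<in> T. \<forall>B \<in> F. Ext_vanishes D (-1) A B) \<and>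
    X = star D X T F}"

definition stors_le :: "'o set \<times> 'o set \<Rightarrow> 'o set \<times> 'o set \<Rightarrow> bool" where
  "stors_le t t' \<longleftrightarrow> fst t \<subseteq> fst t'"

definition shift_pair ::
    "('o, 'm, 'x) triangulated_data_scheme \<Rightarrow> int \<Rightarrow> 'o set \<times> 'o set \<Rightarrow> 'o set \<times> 'o set" where
  "shift_pair D k t = (shift D k ` fst t, shift D k ` snd t)"

definition heart :: "'o set \<times> 'o set \<Rightarrow> 'o set \<times> 'o set \<Rightarrow> 'o set" where
  "heart t t' = snd t \<inter> fst t'"

definition perp ::
    "('o, 'm, 'x) triangulated_data_scheme \<Rightarrow> 'o set \<Rightarrow> int \<Rightarrow> 'o \<Rightarrow> 'o set" where
  "perp D X i V = {Y \<in> X. Ext_vanishes D i V Y}"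

text \<open>\<open>A \<rightarrow> \<Coprod>\<^sub>\<alpha> V \<rightarrow> Y\<close> is a conflation in \<open>X\<close> whose second map \<open>f\<close> is nonzero. Letting \<open>\<alpha>\<close> range
  only over sets of arrows is no restriction, see \<open>copower_index_arrows\<close> below: if \<open>V\<close> is nonzero
  then \<open>\<alpha>\<close> embeds into \<open>Hom V (\<Coprod>\<^sub>\<alpha> V)\<close>.\<close>

definition presentation ::
    "('o, 'm, 'x) triangulated_data_scheme \<Rightarrow> 'o set \<Rightarrow> 'o \<Rightarrow> 'o \<Rightarrow> 'o \<Rightarrow> bool" where
  "presentation D X V A Y \<longleftrightarrow>
    (\<exists>(\<alpha> :: 'm set) P \<iota> e f. is_coproduct D X \<alpha> (\<lambda>_. V) P \<iota> \<and>
      conflation D X A e P f Y \<and> f \<noteq> Zero D P Y)"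

definition Gen :: "('o, 'm, 'x) triangulated_data_scheme \<Rightarrow> 'o set \<Rightarrow> 'o \<Rightarrow> 'o set" where
  "Gen D X V = {Y \<in> X. zero_object D Y \<or> (\<exists>A. presentation D X V A Y)}"

definition Pres :: "('o, 'm, 'x) triangulated_data_scheme \<Rightarrow> 'o set \<Rightarrow> 'o \<Rightarrow> 'o set" where
  "Pres D X V = {Y \<in> X. zero_object D Y \<or> (\<exists>A \<in> Gen D X V. presentation D X V A Y)}"

definition generator :: "('o, 'm, 'x) triangulated_data_scheme \<Rightarrow> 'o set \<Rightarrow> 'o \<Rightarrow> bool" where
  "generator D X V \<longleftrightarrow> V \<in> X \<and> Gen D X V = X"

definition projective :: "('o, 'm, 'x) triangulated_data_scheme \<Rightarrow> 'o set \<Rightarrow> 'o \<Rightarrow> bool" where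
  "projective D X V \<longleftrightarrow> V \<in> X \<and> (\<forall>Y \<in> X. Ext_vanishes D 1 V Y)"

definition projective_generator ::
    "('o, 'm, 'x) triangulated_data_scheme \<Rightarrow> 'o set \<Rightarrow> 'o \<Rightarrow> bool" where
  "projective_generator D X V \<longleftrightarrow> projective D X V \<and> generator D X V"

definition cogenerating :: "('o, 'm, 'x) triangulated_data_scheme \<Rightarrow> 'o set \<Rightarrow> 'o set \<Rightarrow> bool" where
  "cogenerating D X S \<longleftrightarrow> S \<subseteq> X \<and>
    (\<forall>Y \<in> X. \<exists>B \<in> S. \<exists>Y' f g. conflation D X Y f B g Y')"

definition extended_tilting ::
    "('o, 'm, 'x) triangulated_data_scheme \<Rightarrow> 'o set \<Rightarrow> 'o \<Rightarrow> bool" where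
  "extended_tilting D X V \<longleftrightarrow> V \<in> X \<and>
    (Gen D X V, perp D X 0 V) \<in> stors D X \<and>
    Gen D X V = Pres D X V \<and> Gen D X V \<subseteq> perp D X 1 V \<and>
    cogenerating D X (Gen D X V)"


section \<open>Remarks on the definitions\<close>

lemma (in additive_category) Zero_Hom:
  assumes "A \<in> Obj D" "B \<in> Obj D" shows "Zero D A B \<in> Hom D A B"
proof -
  interpret G: comm_group "Hom_group D A B" by (rule Hom_comm_group[OF assms])
  show ?thesis using G.one_closed by (simp add: Hom_group_def)
qed

lemma (in additive_category) Add_idem:
  assumes "f \<in> Hom D A B" "Add D f f = f" shows "f = Zero D A B"
proof -
  have "A \<in> Obj D" "B \<in> Obj D" using assms Dom_Obj Cod_Obj by (auto simp: Hom_def)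
  then interpret G: comm_group "Hom_group D A B" by (rule Hom_comm_group)
  show ?thesis using assms G.l_cancel_one[of f f] by (simp add: Hom_group_def)
qed

lemma (in additive_category) Add_Zero:
  assumes "A \<in> Obj D" "B \<in> Obj D" shows "Add D (Zero D A B) (Zero D A B) = Zero D A B"
proof -
  interpret G: comm_group "Hom_group D A B" by (rule Hom_comm_group[OF assms])
  show ?thesis using G.l_one[OF G.one_closed] by (simp add: Hom_group_def)
qed

lemma (in additive_category) Zero_Comp:
  assumes "f \<in> Hom D A B" "C \<in> Obj D" shows "Zero D B C \<cdot> f = Zero D A C"
proof -
  have B: "B \<in> Obj D" using assms Cod_Obj by (auto simp: Hom_def)
  note Z = Zero_Hom[OF B assms(2)]
  show ?thesis
    using Add_idem[OF Comp_Hom[OF assms(1) Z]] Add_Comp[OF assms(1) Z Z] Add_Zero[OF B assms(2)]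
    by simp
qed

lemma (in additive_category) Comp_Zero:
  assumes "g \<in> Hom D B C" "A \<in> Obj D" shows "g \<cdot> Zero D A B = Zero D A C"
proof -
  have B: "B \<in> Obj D" using assms Dom_Obj by (auto simp: Hom_def)
  note Z = Zero_Hom[OF assms(2) B]
  show ?thesis
    using Add_idem[OF Comp_Hom[OF Z assms(1)]] Comp_Add[OF Z Z assms(1)] Add_Zero[OF assms(2) B]
    by simp
qed

lemma (in additive_category) zero_object_iff:
  "zero_object D Z \<longleftrightarrow> Z \<in> Obj D \<and> Id D Z = Zero D Z Z"
proof
  assume "zero_object D Z"
  then show "Z \<in> Obj D \<and> Id D Z = Zero D Z Z"
    using Id_Hom Zero_Hom unfolding zero_object_def by blast
next
  assume Z: "Z \<in> Obj D \<and> Id D Z = Zero D Z Z"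
  have "f = Zero D A Z" if "f \<in> Hom D A Z" for f A
    using Id_Comp[OF that] Zero_Comp[OF that] Z by simp
  moreover have "f = Zero D Z A" if "f \<in> Hom D Z A" for f A
    using Comp_Id[OF that] Comp_Zero[OF that] Z by simp
  ultimately show "zero_object D Z"
    unfolding zero_object_def using Z Zero_Hom by blast
qed

lemma (in additive_category) copower_index_arrows:
  fixes I :: "'i set" and V :: 'o
  assumes X: "X \<subseteq> Obj D" and V: "V \<in> X" and P: "is_coproduct D X I (\<lambda>_. V) P \<iota>"
  shows "\<exists>(J :: 'm set) \<iota>'. is_coproduct D X J (\<lambda>_. V) P \<iota>'"
proof (cases "zero_object D V")
  case True
  have "is_coproduct D X ({} :: 'm set) (\<lambda>_. V) P id"
    unfolding is_coproduct_def
  proof (intro conjI ballI allI impI)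
    show "P \<in> X" using P by (simp add: is_coproduct_def)
    fix Y assume Y: "Y \<in> X"
    have Hom_V: "f = Zero D V Y" if "f \<in> Hom D V Y" for f
      using True that Zero_Hom X Y V unfolding zero_object_def by blast
    have "\<forall>i \<in> I. Zero D V Y \<in> Hom D V Y" using Zero_Hom X Y V by blast
    then have ex1: "\<exists>!u. u \<in> Hom D P Y \<and> (\<forall>i \<in> I. u \<cdot> \<iota> i = Zero D V Y)"
      using P Y unfolding is_coproduct_def
      by (elim conjE) (drule bspec, assumption, drule spec[where x="\<lambda>_. Zero D V Y"], simp)
    have "u \<cdot> \<iota> i = Zero D V Y" if "u \<in> Hom D P Y" "i \<in> I" for u i
      using that P Comp_Hom Hom_V unfolding is_coproduct_def by blast
    with ex1 have "\<exists>!u. u \<in> Hom D P Y" by metis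
    then show "\<exists>!u. u \<in> Hom D P Y \<and> (\<forall>i \<in> {}. u \<cdot> id i = \<phi> i)" for \<phi> by simp
  qed simp
  then show ?thesis by blast
next
  case False
  have inj: "inj_on \<iota> I"
  proof (rule inj_onI, rule ccontr)
    fix i j assume ij: "i \<in> I" "j \<in> I" "\<iota> i = \<iota> j" "i \<noteq> j"
    define \<phi> where "\<phi> k = (if k = i then Id D V else Zero D V V)" for k
    have "\<forall>k \<in> I. \<phi> k \<in> Hom D V V" using X V Id_Hom Zero_Hom by (auto simp: \<phi>_def)
    then obtain u where "\<forall>k \<in> I. u \<cdot> \<iota> k = \<phi> k"
      using P V unfolding is_coproduct_def by blast
    then have "\<phi> i = \<phi> j" using ij by metis
    then show False using ij False X V by (auto simp: \<phi>_def zero_object_iff)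
  qed
  have "is_coproduct D X (\<iota> ` I) (\<lambda>_. V) P id"
    unfolding is_coproduct_def
  proof (intro conjI ballI allI impI)
    show "P \<in> X" using P by (simp add: is_coproduct_def)
    show "id f \<in> Hom D V P" if "f \<in> \<iota> ` I" for f using that P by (auto simp: is_coproduct_def)
    fix Y \<phi> assume Y: "Y \<in> X" and "\<forall>f \<in> \<iota> ` I. \<phi> f \<in> Hom D V Y"
    then have "\<forall>i \<in> I. (\<phi> \<circ> \<iota>) i \<in> Hom D V Y" by simp
    then have "\<exists>!u. u \<in> Hom D P Y \<and> (\<forall>i \<in> I. u \<cdot> \<iota> i = (\<phi> \<circ> \<iota>) i)"
      using P Y unfolding is_coproduct_def by blast
    then show "\<exists>!u. u \<in> Hom D P Y \<and> (\<forall>f \<in> \<iota> ` I. u \<cdot> id f = \<phi> f)" by simp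
  qed
  then show ?thesis by blast
qed


text \<open>The object \<open>V = 0\<close> is exceptional. Let \<open>t\<^sub>1\<close> and \<open>t\<^sub>2\<close> be the trivial \<open>s\<close>-torsion pairs
  \<open>(0, D)\<close> and \<open>(D, 0)\<close>, so that \<open>t\<^sub>1 \<le> t\<^sub>2 = \<Sigma>t\<^sub>2 = \<Sigma>\<^sup>-\<^sup>1t\<^sub>2\<close> and \<open>\<H>[t\<^sub>1, \<Sigma>\<^sup>-\<^sup>1t\<^sub>2] = D\<close>. Then \<open>0\<close> is
  extended tilting in \<open>D\<close>, because \<open>Y \<rightarrow> 0 \<rightarrow> \<Sigma>Y\<close> is a conflation for every \<open>Y\<close>; but \<open>Gen(0) = 0\<close>
  while \<open>Ext 1\<close> from \<open>0\<close> vanishes on all of \<open>D\<close>. Hence a comparison of the extended tilting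
  property with \<open>Gen(V) = V\<^sup>\<bottom>\<^sup>1\<close> needs \<open>V\<close> to be nonzero unless the heart itself is zero.\<close>

lemma (in triangulated_category) SO_Obj: "A \<in> Obj D \<Longrightarrow> SO D A \<in> Obj D"
  using SO_bij by (auto simp: bij_betw_def)

lemma (in triangulated_category) shift_Obj:
  "shift D 1 ` Obj D = Obj D" "shift D (-1) ` Obj D = Obj D" "shift D 0 A = A"
proof -
  show "shift D 1 ` Obj D = Obj D" using SO_bij by (simp add: shift_def bij_betw_def)
  show "shift D (-1) ` Obj D = Obj D"
    using bij_betw_inv_into[OF SO_bij] by (simp add: shift_def bij_betw_def)
qed (simp add: shift_def)

lemma (in triangulated_category) SA_Zero:
  assumes "A \<in> Obj D" "B \<in> Obj D" shows "SA D (Zero D A B) = Zero D (SO D A) (SO D B)"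
  using Add_idem[OF SA_Hom[OF Zero_Hom[OF assms]]]
    SA_Add[OF Zero_Hom[OF assms] Zero_Hom[OF assms]] Add_Zero[OF assms] by simp

lemma (in triangulated_category) zero_object_SO:
  assumes "A \<in> Obj D" shows "zero_object D (SO D A) \<longleftrightarrow> zero_object D A"
proof -
  have "Id D A \<in> Arr D" "Zero D A A \<in> Arr D"
    using Id_Hom Zero_Hom assms by (auto simp: Hom_def)
  then have "SA D (Id D A) = SA D (Zero D A A) \<longleftrightarrow> Id D A = Zero D A A"
    using SA_bij by (auto simp: bij_betw_def dest: inj_onD)
  then show ?thesis using assms SO_Obj by (simp add: zero_object_iff SA_Id SA_Zero)
qed

lemma (in triangulated_category) shift_zero_objects:
  "shift D 1 ` {Z. zero_object D Z} = {Z. zero_object D Z}"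
  "shift D (-1) ` {Z. zero_object D Z} = {Z. zero_object D Z}"
proof -
  let ?N = "{Z. zero_object D Z}" and ?S = "inv_into (Obj D) (SO D)"
  have N: "?N \<subseteq> Obj D" by (auto simp: zero_object_def)
  have inv: "?S A \<in> Obj D" "SO D (?S A) = A" "?S (SO D A) = A" if "A \<in> Obj D" for A
    using that SO_bij by (auto simp: bij_betw_def inv_into_into f_inv_into_f)
  have 1: "SO D ` ?N \<subseteq> ?N" using N zero_object_SO by auto
  have 2: "?S ` ?N \<subseteq> ?N"
  proof (rule image_subsetI)
    fix Z assume "Z \<in> ?N"
    with N have "Z \<in> Obj D" "zero_object D (SO D (?S Z))" using inv(2) by auto
    then show "?S Z \<in> ?N" using zero_object_SO[OF inv(1)] by simp
  qed
  have "?N \<subseteq> SO D ` ?N"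
  proof
    fix Z assume "Z \<in> ?N"
    with 2 N have "Z = SO D (?S Z)" "?S Z \<in> ?N" using inv(2)[of Z] by auto
    then show "Z \<in> SO D ` ?N" by (rule image_eqI)
  qed
  with 1 show "shift D 1 ` ?N = ?N" by (simp add: shift_def)
  have "?N \<subseteq> ?S ` ?N"
  proof
    fix Z assume "Z \<in> ?N"
    with 1 N have "Z = ?S (SO D Z)" "SO D Z \<in> ?N" using inv(3)[of Z] by auto
    then show "Z \<in> ?S ` ?N" by (rule image_eqI)
  qed
  with 2 show "shift D (-1) ` ?N = ?N" by (simp add: shift_def)
qed

lemma (in triangulated_category) trivial_conflations:
  assumes A: "A \<in> Obj D" and Z: "zero_object D Z"
  shows "\<exists>f g. conflation D (Obj D) A f A g Z"
    and "\<exists>Y f g. zero_object D Y \<and> conflation D (Obj D) Y f A g A"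
    and "\<exists>B f g. conflation D (Obj D) A f Z g B"
proof -
  have ZO: "Z \<in> Obj D" using Z by (simp add: zero_object_def)
  note T = TR1_Id[OF A Z]
  have H: "Id D A \<in> Hom D A A" "Zero D A Z \<in> Hom D A Z" "Zero D Z (SO D A) \<in> Hom D Z (SO D A)"
    using A ZO Id_Hom Zero_Hom SO_Obj by auto
  show "\<exists>f g. conflation D (Obj D) A f A g Z"
    unfolding conflation_def using A ZO T H by blast
  have R: "(Zero D A Z, Zero D Z (SO D A), Neg D (SA D (Id D A))) \<in> Dist D"
    using TR2[OF H] T by blast
  have N: "Neg D (SA D (Id D A)) \<in> Hom D (SO D A) (SO D A)"
    using Dist_Hom[OF R] H(2,3) by (auto simp: Hom_def)
  show "\<exists>B f g. conflation D (Obj D) A f Z g B"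
    unfolding conflation_def using A ZO SO_Obj[OF A] R H N by blast
  obtain Y where Y: "Y \<in> Obj D" "SO D Y = Z" using SO_bij ZO unfolding bij_betw_def by (metis imageE)
  have YZ: "zero_object D Y" using zero_object_SO[OF Y(1)] Z Y(2) by simp
  have k: "Zero D A Z \<in> Hom D A (SO D Y)" using H Y by simp
  have q: "Zero D Y A \<in> Hom D Y A" using Zero_Hom A Y by simp
  interpret G: comm_group "Hom_group D Z (SO D A)" by (rule Hom_comm_group[OF ZO SO_Obj[OF A]])
  have "Dom D (Zero D Z (SO D A)) = Z" "Cod D (Zero D Z (SO D A)) = SO D A"
    using H by (auto simp: Hom_def)
  then have "Neg D (SA D (Zero D Y A)) = Zero D Z (SO D A)"
    using G.inv_one SA_Zero[OF Y(1) A] Y by (simp add: Neg_def Hom_group_def)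
  then have "(Zero D Y A, Id D A, Zero D A Z) \<in> Dist D"
    using TR2[OF q H(1) k] T by simp
  then show "\<exists>Y f g. zero_object D Y \<and> conflation D (Obj D) Y f A g A"
    unfolding conflation_def using A Y YZ q H k by blast
qed

lemma (in additive_category) zero_object_iso:
  assumes "zero_object D A" "isomorphic D A B" shows "zero_object D B"
proof -
  obtain f g where f: "f \<in> Hom D A B" and g: "g \<in> Hom D B A" and fg: "f \<cdot> g = Id D B"
    using assms(2) unfolding isomorphic_def iso_arr_def Hom_def by auto
  have O: "A \<in> Obj D" "B \<in> Obj D" using f Dom_Obj Cod_Obj by (auto simp: Hom_def)
  have "f = Zero D A B" using assms(1) f O Zero_Hom unfolding zero_object_def by blast
  then show ?thesis using fg Zero_Comp[OF g O(2)] O by (simp add: zero_object_iff)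
qed

lemma (in triangulated_category) zero_extended_tilting:
  defines "N \<equiv> {Z. zero_object D Z}"
  defines "t\<^sub>1 \<equiv> (N, Obj D)" and "t\<^sub>2 \<equiv> (Obj D, N)"
  assumes V: "zero_object D V" and nonzero: "\<exists>Y \<in> Obj D. \<not> zero_object D Y"
  shows "t\<^sub>1 \<in> stors D (Obj D)" "t\<^sub>2 \<in> stors D (Obj D)" "stors_le t\<^sub>1 t\<^sub>2"
    "shift_pair D 1 t\<^sub>2 = t\<^sub>2" "shift_pair D (-1) t\<^sub>2 = t\<^sub>2" "heart t\<^sub>1 t\<^sub>2 = Obj D"
    "extended_tilting D (heart t\<^sub>1 t\<^sub>2) V"
    "Gen D (heart t\<^sub>1 t\<^sub>2) V \<noteq> perp D (heart t\<^sub>1 t\<^sub>2) 1 V"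
    "\<not> generator D (heart t\<^sub>1 t\<^sub>2) V"
    "t\<^sub>1 \<noteq> shift_pair D 1 t\<^sub>2"
proof -
  have N: "N \<subseteq> Obj D" by (auto simp: N_def zero_object_def)
  have VO: "V \<in> Obj D" using V by (simp add: zero_object_def)
  have sh: "shift D (-1) B \<in> Obj D" "shift D 0 B \<in> Obj D" "shift D 1 B \<in> Obj D" if "B \<in> Obj D" for B
    using shift_Obj that by auto
  have shN: "shift D (-1) B \<in> N" "shift D 0 B \<in> N" if "B \<in> N" for B
    using shift_zero_objects shift_Obj that by (auto simp: N_def)
  have HomN: "Hom D A B = {Zero D A B}" if "A \<in> N \<or> B \<in> N" "A \<in> Obj D" "B \<in> Obj D" for A B
    using that Zero_Hom unfolding N_def zero_object_def by blast
  have van1: "Ext_vanishes D i A B" if "i \<in> {-1, 0, 1}" "A \<in> N" "B \<in> Obj D" for i A B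
  proof -
    have "shift D i B \<in> Obj D" using that(1) sh[OF that(3)] by blast
    then show ?thesis using HomN that(2) N unfolding Ext_vanishes_def Ext_def by blast
  qed
  have van2: "Ext_vanishes D i A B" if "i \<in> {-1, 0}" "A \<in> Obj D" "B \<in> N" for i A B
  proof -
    have "shift D i B \<in> N" using that(1) shN[OF that(3)] by blast
    then show ?thesis using HomN that(2) N unfolding Ext_vanishes_def Ext_def by blast
  qed
  have iso: "iso_closed_in D (Obj D) N" "iso_closed_in D (Obj D) (Obj D)"
    unfolding iso_closed_in_def using zero_object_iso N by (unfold N_def) blast+
  have star: "Obj D = star D (Obj D) N (Obj D)" "Obj D = star D (Obj D) (Obj D) N"
  proof -
    have "C \<in> star D (Obj D) N (Obj D)" "C \<in> star D (Obj D) (Obj D) N" if "C \<in> Obj D" for C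
      using trivial_conflations[OF that V] that V unfolding star_def N_def by blast+
    moreover have "star D (Obj D) S T \<subseteq> Obj D" for S T by (auto simp: star_def conflation_def)
    ultimately show "Obj D = star D (Obj D) N (Obj D)" "Obj D = star D (Obj D) (Obj D) N"
      by blast+
  qed
  show t1: "t\<^sub>1 \<in> stors D (Obj D)" and "t\<^sub>2 \<in> stors D (Obj D)"
    unfolding t\<^sub>1_def t\<^sub>2_def stors_def mem_Collect_eq prod.case
    using iso star van1 van2 by blast+
  show "stors_le t\<^sub>1 t\<^sub>2" using N by (simp add: stors_le_def t\<^sub>1_def t\<^sub>2_def)
  show sh1: "shift_pair D 1 t\<^sub>2 = t\<^sub>2" and "shift_pair D (-1) t\<^sub>2 = t\<^sub>2"
    using shift_Obj shift_zero_objects by (simp_all add: shift_pair_def t\<^sub>2_def N_def)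
  show h: "heart t\<^sub>1 t\<^sub>2 = Obj D" by (simp add: heart_def t\<^sub>1_def t\<^sub>2_def)
  show "t\<^sub>1 \<noteq> shift_pair D 1 t\<^sub>2" using nonzero sh1 by (auto simp: t\<^sub>1_def t\<^sub>2_def N_def)
  have pres: "\<not> presentation D (Obj D) V A Y" for A Y
  proof
    assume "presentation D (Obj D) V A Y"
    then obtain \<alpha> :: "'m set" and P \<iota> e f where P: "is_coproduct D (Obj D) \<alpha> (\<lambda>_. V) P \<iota>"
      and f: "conflation D (Obj D) A e P f Y" "f \<noteq> Zero D P Y" unfolding presentation_def by blast
    have H: "f \<in> Hom D P Y" and O: "Y \<in> Obj D" "P \<in> Obj D" using f by (auto simp: conflation_def)
    note Z = Zero_Hom[OF O(2,1)]
    have Hom_V: "Hom D V Y = {Zero D V Y}" using HomN V VO O by (simp add: N_def)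
    have u: "u \<cdot> \<iota> i = Zero D V Y" if "u \<in> Hom D P Y" "i \<in> \<alpha>" for u i
      using that P Comp_Hom Hom_V unfolding is_coproduct_def by blast
    have "\<exists>!u. u \<in> Hom D P Y \<and> (\<forall>i \<in> \<alpha>. u \<cdot> \<iota> i = Zero D V Y)"
      using P O Zero_Hom[OF VO O(1)] unfolding is_coproduct_def
      by (elim conjE) (drule bspec, assumption, drule spec[where x="\<lambda>_. Zero D V Y"], simp)
    then show False using u H Z f(2) by blast
  qed
  have Gen: "Gen D (Obj D) V = N" and Pres: "Pres D (Obj D) V = N"
    using pres N by (auto simp: Gen_def Pres_def N_def)
  have perp: "perp D (Obj D) i V = Obj D" if "i \<in> {0, 1}" for i
    using van1[of i V] that V by (auto simp: perp_def N_def)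
  have "cogenerating D (Obj D) N"
    unfolding cogenerating_def using N trivial_conflations(3)[OF _ V] V unfolding N_def by blast
  then show "extended_tilting D (heart t\<^sub>1 t\<^sub>2) V"
    using VO t1 N unfolding extended_tilting_def h Gen Pres by (simp add: perp t\<^sub>1_def)
  show "Gen D (heart t\<^sub>1 t\<^sub>2) V \<noteq> perp D (heart t\<^sub>1 t\<^sub>2) 1 V" "\<not> generator D (heart t\<^sub>1 t\<^sub>2) V"
    using nonzero by (auto simp: h Gen perp generator_def N_def)
qed

end

theory Submission
  imports Defs
begin

text \<open>Let \<open>X\<close> and \<open>C\<close> be the hearts of \<open>[t\<^sub>1, t\<^sub>3]\<close> and \<open>[t\<^sub>1, t\<^sub>2]\<close>; then \<open>\<Sigma>\<^sup>-\<^sup>1C \<subseteq> X\<close>.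

  If \<open>V\<close> is a projective generator of \<open>C\<close>, an object \<open>M\<close> of \<open>\<F>\<^sub>1 \<inter> \<Sigma>\<T>\<^sub>2\<close> satisfies
  \<open>Hom(V, M) = Ext\<^sup>1(V, \<Sigma>\<^sup>-\<^sup>1M) = 0\<close> and hence vanishes, so \<open>t\<^sub>1 = \<Sigma>t\<^sub>2\<close>. If moreover \<open>C\<close> is
  cogenerating, then \<open>Ext\<^sup>2(V, C) = 0\<close>, so \<open>Ext\<^sup>1(V, Y)\<close> detects the part of \<open>Y \<in> X\<close> outside \<open>C\<close>,
  and \<open>C\<close> is both \<open>Gen(V)\<close> and the \<open>Ext\<^sup>1\<close>-orthogonal of \<open>V\<close> in \<open>X\<close>.

  If \<open>V \<noteq> 0\<close> is extended tilting, then \<open>C \<subseteq> Gen(V)\<close>. In the decomposition \<open>A \<rightarrow> V \<rightarrow> B\<close> of \<open>V\<close>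
  with respect to \<open>t\<^sub>2\<close>, \<open>B\<close> is torsion for \<open>(Gen(V), V\<^sup>\<bottom>\<^sup>0)\<close>, so \<open>Hom(V, \<Sigma>B) = 0\<close>; since
  \<open>\<Sigma>B \<in> C \<subseteq> Gen(V)\<close>, this forces \<open>B = 0\<close>. Hence \<open>V \<in> C\<close> and \<open>Gen(V) = C\<close>.\<close>

section \<open>Additive categories\<close>

text \<open>All orthogonality conditions are used in this one form; shifts are moved onto an
  argument, so that no inverse shift is needed to state them.\<close>

definition orth :: "('o, 'm, 'x) additive_data_scheme \<Rightarrow> 'o \<Rightarrow> 'o \<Rightarrow> bool" where
  "orth D A B \<longleftrightarrow> (\<forall>f \<in> Hom D A B. f = Zero D A B)"

context additive_category
begin

lemma Hom_Obj: "f \<in> Hom D A B \<Longrightarrow> A \<in> Obj D" "f \<in> Hom D A B \<Longrightarrow> B \<in> Obj D"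
  using Dom_Obj Cod_Obj by (auto simp: Hom_def)

lemma Neg_Hom: assumes "f \<in> Hom D A B" shows "Neg D f \<in> Hom D A B"
proof -
  interpret G: comm_group "Hom_group D A B" by (rule Hom_comm_group[OF Hom_Obj[OF assms]])
  show ?thesis using assms G.inv_closed[of f] by (auto simp: Neg_def Hom_def Hom_group_def)
qed

lemma Add_Neg: assumes "f \<in> Hom D A B" shows "Add D f (Neg D f) = Zero D A B"
proof -
  interpret G: comm_group "Hom_group D A B" by (rule Hom_comm_group[OF Hom_Obj[OF assms]])
  show ?thesis using assms G.r_inv[of f] by (auto simp: Neg_def Hom_def Hom_group_def)
qed

lemma Add_eq_ZeroD:
  assumes "f \<in> Hom D A B" "g \<in> Hom D A B" "Add D f g = Zero D A B" shows "g = Neg D f"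
proof -
  interpret G: comm_group "Hom_group D A B" by (rule Hom_comm_group[OF Hom_Obj[OF assms(1)]])
  have "f \<otimes>\<^bsub>Hom_group D A B\<^esub> g = f \<otimes>\<^bsub>Hom_group D A B\<^esub> Neg D f"
    using assms Add_Neg[OF assms(1)] by (simp add: Hom_group_def)
  then show ?thesis using G.Units_l_cancel[of f g "Neg D f"] G.Units_eq assms Neg_Hom[OF assms(1)]
    by (simp add: Hom_group_def)
qed

lemma Add_commute:
  assumes "f \<in> Hom D A B" "g \<in> Hom D A B" shows "Add D f g = Add D g f"
proof -
  interpret G: comm_group "Hom_group D A B" by (rule Hom_comm_group[OF Hom_Obj[OF assms(1)]])
  show ?thesis using G.m_comm[of f g] assms by (simp add: Hom_group_def)
qed

lemma Neg_Neg: assumes "f \<in> Hom D A B" shows "Neg D (Neg D f) = f"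
  by (rule Add_eq_ZeroD[OF Neg_Hom[OF assms] assms, symmetric])
    (simp add: Add_Neg[OF assms] Add_commute[OF Neg_Hom[OF assms] assms])

lemma Neg_inject:
  "\<lbrakk>f \<in> Hom D A B; g \<in> Hom D A B; Neg D f = Neg D g\<rbrakk> \<Longrightarrow> f = g"
  by (metis Neg_Neg)

lemma Neg_Zero: assumes "A \<in> Obj D" "B \<in> Obj D" shows "Neg D (Zero D A B) = Zero D A B"
  by (rule Add_eq_ZeroD[OF Zero_Hom[OF assms] Zero_Hom[OF assms] Add_Zero[OF assms], symmetric])

lemma Neg_Comp:
  assumes "f \<in> Hom D A B" "g \<in> Hom D B C" shows "Neg D g \<cdot> f = Neg D (g \<cdot> f)"
  using Add_Comp[OF assms Neg_Hom[OF assms(2)]] Add_Neg[OF assms(2)]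
    Zero_Comp[OF assms(1) Hom_Obj(2)[OF assms(2)]]
    Add_eq_ZeroD[OF Comp_Hom[OF assms] Comp_Hom[OF assms(1) Neg_Hom[OF assms(2)]]] by simp

lemma Comp_Neg:
  assumes "f \<in> Hom D A B" "g \<in> Hom D B C" shows "g \<cdot> Neg D f = Neg D (g \<cdot> f)"
  using Comp_Add[OF assms(1) Neg_Hom[OF assms(1)] assms(2)] Add_Neg[OF assms(1)]
    Comp_Zero[OF assms(2) Hom_Obj(1)[OF assms(1)]]
    Add_eq_ZeroD[OF Comp_Hom[OF assms] Comp_Hom[OF Neg_Hom[OF assms(1)] assms(2)]] by simp

text \<open>The difference of \<open>x\<close> and \<open>y\<close> is killed by \<open>g\<close>. A
  trivial kernel is demanded for the source \<open>A\<close> only, since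
  \<open>tri_lift_unique\<close> yields it for particular sources.\<close>

lemma Comp_inject:
  assumes g: "g \<in> Hom D B C" and x: "x \<in> Hom D A B" "y \<in> Hom D A B" and eq: "g \<cdot> x = g \<cdot> y"
    and mono: "\<And>d. \<lbrakk>d \<in> Hom D A B; g \<cdot> d = Zero D A C\<rbrakk> \<Longrightarrow> d = Zero D A B"
  shows "x = y"
proof -
  have "\<exists>d \<in> Hom D A B. d = Add D x (Neg D y)"
  proof -
    interpret G: comm_group "Hom_group D A B" by (rule Hom_comm_group[OF Hom_Obj[OF x(1)]])
    show ?thesis using G.m_closed[of x "Neg D y"] x Neg_Hom by (simp add: Hom_group_def)
  qed
  moreover have "g \<cdot> Add D x (Neg D y) = Zero D A C"
    using Comp_Add[OF x(1) Neg_Hom[OF x(2)] g] Comp_Neg[OF x(2) g] Add_Neg[OF Comp_Hom[OF x(1) g]]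
      eq by simp
  ultimately have "Add D x (Neg D y) = Zero D A B" using mono by simp
  then have "Neg D y = Neg D x" using Add_eq_ZeroD[OF x(1) Neg_Hom[OF x(2)]] by simp
  then show ?thesis using Neg_inject x by metis
qed

lemma orthD: "\<lbrakk>orth D A B; f \<in> Hom D A B\<rbrakk> \<Longrightarrow> f = Zero D A B"
  by (simp add: orth_def)

lemma zero_object_Obj: "zero_object D Z \<Longrightarrow> Z \<in> Obj D"
  by (simp add: zero_object_def)

lemma orth_zero_object:
  assumes "zero_object D Z" shows "orth D Z A" "orth D A Z"
proof -
  have Z: "Z \<in> Obj D" "Id D Z = Zero D Z Z" using assms by (simp_all add: zero_object_iff)
  show "orth D Z A"
    unfolding orth_def
  proof
    fix f assume f: "f \<in> Hom D Z A"
    show "f = Zero D Z A" using Comp_Id[OF f] Comp_Zero[OF f Z(1)] Z(2) by simp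
  qed
  show "orth D A Z"
    unfolding orth_def
  proof
    fix f assume f: "f \<in> Hom D A Z"
    show "f = Zero D A Z" using Id_Comp[OF f] Zero_Comp[OF f Z(1)] Z(2) by simp
  qed
qed

lemma orth_self_iff:
  assumes "A \<in> Obj D" shows "orth D A A \<longleftrightarrow> zero_object D A"
proof
  assume "orth D A A"
  then show "zero_object D A" using orthD[OF _ Id_Hom[OF assms]] assms by (simp only: zero_object_iff simp_thms)
next
  assume "zero_object D A"
  then show "orth D A A" by (rule orth_zero_object)
qed

lemma orth_retract:
  assumes "s \<in> Hom D Y E" "r \<in> Hom D E Y" "r \<cdot> s = Id D Y"
  shows "orth D E N \<Longrightarrow> orth D Y N" "orth D N E \<Longrightarrow> orth D N Y"
proof -
  show "orth D Y N" if "orth D E N"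
    unfolding orth_def
  proof
    fix u assume u: "u \<in> Hom D Y N"
    have "u \<cdot> r = Zero D E N" using orthD[OF that Comp_Hom[OF assms(2) u]] .
    then have "u \<cdot> (r \<cdot> s) = Zero D Y N"
      using Comp_assoc[OF assms(1,2) u] Zero_Comp[OF assms(1) Hom_Obj(2)[OF u]] by simp
    then show "u = Zero D Y N" using Comp_Id[OF u] assms(3) by simp
  qed
  show "orth D N Y" if "orth D N E"
    unfolding orth_def
  proof
    fix u assume u: "u \<in> Hom D N Y"
    have "s \<cdot> u = Zero D N E" using orthD[OF that Comp_Hom[OF u assms(1)]] .
    then have "(r \<cdot> s) \<cdot> u = Zero D N Y"
      using Comp_assoc[OF u assms(1,2)] Comp_Zero[OF assms(2) Hom_Obj(1)[OF u]] by simp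
    then show "u = Zero D N Y" using Id_Comp[OF u] assms(3) by simp
  qed
qed

lemma isomorphicE:
  assumes "isomorphic D A B"
  obtains f g where "f \<in> Hom D A B" "g \<in> Hom D B A" "g \<cdot> f = Id D A" "f \<cdot> g = Id D B"
proof -
  obtain f where f: "f \<in> Hom D A B" "iso_arr D f" using assms unfolding isomorphic_def by blast
  then have "Dom D f = A" "Cod D f = B" by (auto simp: Hom_def)
  with f that show thesis unfolding iso_arr_def by blast
qed

lemma orth_isomorphic:
  assumes "isomorphic D A B"
  shows "orth D A N \<Longrightarrow> orth D B N" "orth D N A \<Longrightarrow> orth D N B"
proof -
  obtain f g where "f \<in> Hom D A B" "g \<in> Hom D B A" "g \<cdot> f = Id D A" "f \<cdot> g = Id D B"
    using isomorphicE[OF assms] .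
  then show "orth D A N \<Longrightarrow> orth D B N" "orth D N A \<Longrightarrow> orth D N B" using orth_retract by blast+
qed

end


section \<open>Triangulated categories\<close>

definition tri ::
    "('o, 'm, 'x) triangulated_data_scheme \<Rightarrow> 'o \<Rightarrow> 'o \<Rightarrow> 'o \<Rightarrow> 'm \<Rightarrow> 'm \<Rightarrow> 'm \<Rightarrow> bool" where
  "tri D A B C f g h \<longleftrightarrow> f \<in> Hom D A B \<and> g \<in> Hom D B C \<and> h \<in> Hom D C (SO D A) \<and> (f, g, h) \<in> Dist D"

context triangulated_category
begin

lemma triD:
  assumes "tri D A B C f g h"
  shows "f \<in> Hom D A B" "g \<in> Hom D B C" "h \<in> Hom D C (SO D A)"
    "A \<in> Obj D" "B \<in> Obj D" "C \<in> Obj D"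
  using assms Hom_Obj unfolding tri_def by blast+

lemma tri_rotate: "tri D A B C f g h \<Longrightarrow> tri D B C (SO D A) g h (Neg D (SA D f))"
  unfolding tri_def using TR2[of f A B g C h] Neg_Hom[OF SA_Hom, of f A B] by simp

lemma SO_surj: "B \<in> Obj D \<Longrightarrow> \<exists>A. A \<in> Obj D \<and> SO D A = B"
  by (metis SO_bij bij_betw_imp_surj_on imageE)

lemma SO_inject: "\<lbrakk>A \<in> Obj D; B \<in> Obj D; SO D A = SO D B\<rbrakk> \<Longrightarrow> A = B"
  by (rule inj_onD[OF bij_betw_imp_inj_on[OF SO_bij]])

lemma SA_inject: "\<lbrakk>f \<in> Hom D A B; g \<in> Hom D A B; SA D f = SA D g\<rbrakk> \<Longrightarrow> f = g"
  by (rule inj_onD[OF bij_betw_imp_inj_on[OF SA_bij]]) (simp_all add: Hom_def)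

lemma SA_full:
  assumes "A \<in> Obj D" "B \<in> Obj D" "f \<in> Hom D (SO D A) (SO D B)"
  shows "\<exists>g. g \<in> Hom D A B \<and> SA D g = f"
proof -
  have "f \<in> SA D ` Arr D" using assms(3) bij_betw_imp_surj_on[OF SA_bij] by (simp add: Hom_def)
  then obtain g where g: "g \<in> Arr D" "SA D g = f" by blast
  then have h: "g \<in> Hom D (Dom D g) (Cod D g)" by (simp add: Hom_def)
  have "SO D (Dom D g) = SO D A" "SO D (Cod D g) = SO D B"
    using SA_Hom[OF h] g(2) assms(3) by (auto simp: Hom_def)
  then have "Dom D g = A" "Cod D g = B"
    using SO_inject[OF Hom_Obj(1)[OF h] assms(1)] SO_inject[OF Hom_Obj(2)[OF h] assms(2)] by simp_all
  with h g(2) show ?thesis by blast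
qed

lemma orth_SO: assumes "A \<in> Obj D" "B \<in> Obj D"
  shows "orth D (SO D A) (SO D B) \<longleftrightarrow> orth D A B"
proof
  assume o: "orth D (SO D A) (SO D B)"
  show "orth D A B"
    unfolding orth_def
  proof
    fix f assume f: "f \<in> Hom D A B"
    have "SA D f = SA D (Zero D A B)" using orthD[OF o SA_Hom[OF f]] SA_Zero[OF assms] by simp
    then show "f = Zero D A B" by (rule SA_inject[OF f Zero_Hom[OF assms]])
  qed
next
  assume o: "orth D A B"
  show "orth D (SO D A) (SO D B)"
    unfolding orth_def
  proof
    fix f assume "f \<in> Hom D (SO D A) (SO D B)"
    then obtain g where g: "g \<in> Hom D A B" "SA D g = f" using SA_full[OF assms] by blast
    then show "f = Zero D (SO D A) (SO D B)" using orthD[OF o g(1)] SA_Zero[OF assms] by simp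
  qed
qed

text \<open>In degree \<open>-1\<close>, applying the shift turns arrows into the desuspension of
  \<open>B\<close> into arrows from \<open>SO D A\<close> to \<open>B\<close>.\<close>

lemma Ext_vanishes_iff:
  assumes "A \<in> Obj D" "B \<in> Obj D"
  shows "Ext_vanishes D 0 A B \<longleftrightarrow> orth D A B"
    "Ext_vanishes D 1 A B \<longleftrightarrow> orth D A (SO D B)"
    "Ext_vanishes D (-1) A B \<longleftrightarrow> orth D (SO D A) B"
proof -
  have *: "Hom D A B' = {Zero D A B'} \<longleftrightarrow> orth D A B'" if "B' \<in> Obj D" for B'
    using Zero_Hom[OF assms(1) that] by (auto simp: orth_def)
  show "Ext_vanishes D 0 A B \<longleftrightarrow> orth D A B"
    using *[OF assms(2)] by (simp add: Ext_vanishes_def Ext_def shift_def)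
  show "Ext_vanishes D 1 A B \<longleftrightarrow> orth D A (SO D B)"
    using *[OF SO_Obj[OF assms(2)]] by (simp add: Ext_vanishes_def Ext_def shift_def)
  obtain B' where B': "B' \<in> Obj D" "SO D B' = B" using SO_surj assms by blast
  then have "shift D (-1) B = B'"
    using SO_bij inv_into_f_f[of "SO D" "Obj D" B'] by (simp add: shift_def bij_betw_def)
  then show "Ext_vanishes D (-1) A B \<longleftrightarrow> orth D (SO D A) B"
    using *[OF B'(1)] orth_SO[OF assms(1) B'(1)] B'(2) by (simp add: Ext_vanishes_def Ext_def)
qed

lemma tri_rotate_back:
  assumes t: "tri D B C (SO D A) g h k" and A: "A \<in> Obj D"
  obtains f where "tri D A B C f g h"
proof -
  note B = triD(4)[OF t]
  obtain f where f: "f \<in> Hom D A B" "SA D f = Neg D k"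
    using SA_full[OF A B Neg_Hom] t unfolding tri_def by blast
  have "Neg D (SA D f) = k" using f(2) Neg_Neg triD(3)[OF t] by simp
  then have "tri D A B C f g h" using t f(1) TR2[OF f(1), of g C h] unfolding tri_def by simp
  then show thesis by (rule that)
qed

lemma tri_cone:
  assumes f: "f \<in> Hom D A B"
  obtains C g h where "tri D A B C f g h"
proof -
  have "f \<in> Arr D" using f by (simp add: Hom_def)
  then obtain g h where d: "(f, g, h) \<in> Dist D" using TR1_cone by blast
  obtain A' B' C where H: "f \<in> Hom D A' B'" "g \<in> Hom D B' C" "h \<in> Hom D C (SO D A')"
    using Dist_Hom[OF d] by blast
  have "A' = A" "B' = B" using H(1) f by (auto simp: Hom_def)
  then show thesis using that[of C g h] d f H by (simp add: tri_def)
qed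

text \<open>Complete \<open>u\<close> to a triangle, write its cone as a suspension and rotate back
  twice.\<close>

lemma tri_third:
  assumes u: "u \<in> Hom D C (SO D A)" and A: "A \<in> Obj D"
  obtains E f g where "tri D A E C f g u"
proof -
  obtain G g' h' where G: "tri D C (SO D A) G u g' h'" using tri_cone[OF u] .
  obtain E where E: "E \<in> Obj D" "SO D E = G" using SO_surj triD(6)[OF G] by blast
  have "tri D C (SO D A) (SO D E) u g' h'" using G E(2) by simp
  then obtain g where "tri D E C (SO D A) g u g'" using tri_rotate_back[OF _ E(1)] by blast
  then obtain f where "tri D A E C f g u" using tri_rotate_back[OF _ A] by blast
  then show thesis by (rule that)
qed

lemma tri_map:
  assumes "tri D A B C f g h" "tri D A' B' C' f' g' h'"
    and "a \<in> Hom D A A'" "b \<in> Hom D B B'" "b \<cdot> f = f' \<cdot> a"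
  obtains c where "c \<in> Hom D C C'" "c \<cdot> g = g' \<cdot> b" "SA D a \<cdot> h = h' \<cdot> c"
proof -
  have "\<exists>c \<in> Hom D C C'. c \<cdot> g = g' \<cdot> b \<and> SA D a \<cdot> h = h' \<cdot> c"
    by (rule TR3[of f g h f' g' h' A B C A' B' C' a b]) (use assms in \<open>simp_all add: tri_def\<close>)
  then show thesis using that by blast
qed

text \<open>As \<open>u \<cdot> f\<close> vanishes, TR3 extends \<open>u\<close> to a morphism into
  the triangle on \<open>Id D K\<close>, rotated back so that a zero object comes first; its third
  component is \<open>v\<close>.\<close>

lemma tri_factor_cone:
  assumes t: "tri D A B C f g h" and u: "u \<in> Hom D B K" "u \<cdot> f = Zero D A K"
  obtains v where "v \<in> Hom D C K" "v \<cdot> g = u"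
proof -
  note tt = triD[OF t]
  have K: "K \<in> Obj D" using Hom_Obj u by blast
  obtain Z where Z: "zero_object D Z" using ex_zero_object by blast
  obtain Y where Y: "Y \<in> Obj D" "SO D Y = Z" using SO_surj[OF zero_object_Obj[OF Z]] by blast
  have "tri D K K (SO D Y) (Id D K) (Zero D K Z) (Zero D Z (SO D K))"
    using TR1_Id[OF K Z] Id_Hom Zero_Hom SO_Obj K zero_object_Obj[OF Z] Y by (simp add: tri_def)
  from tri_rotate_back[OF this Y(1)] obtain q where q: "tri D Y K K q (Id D K) (Zero D K Z)" .
  have a: "Zero D A Y \<in> Hom D A Y" using Zero_Hom[OF tt(4) Y(1)] .
  have "u \<cdot> f = q \<cdot> Zero D A Y" using u(2) Comp_Zero[OF triD(1)[OF q] tt(4)] by simp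
  from tri_map[OF t q a u(1) this] obtain c where "c \<in> Hom D C K" "c \<cdot> g = Id D K \<cdot> u" .
  then show thesis using that[of c] Id_Comp[OF u(1)] by simp
qed

text \<open>TR3 only produces a third component, so the identity triangle of \<open>K\<close> and
  the given triangle are both rotated forward; the component obtained is the shift of
  \<open>v\<close>, and the two signs cancel.\<close>

lemma tri_lift:
  assumes t: "tri D A B C f g h" and u: "u \<in> Hom D K B" "g \<cdot> u = Zero D K C"
  obtains v where "v \<in> Hom D K A" "f \<cdot> v = u"
proof -
  note tt = triD[OF t]
  have K: "K \<in> Obj D" using Hom_Obj u by blast
  obtain Z where Z: "zero_object D Z" using ex_zero_object by blast
  note ZO = zero_object_Obj[OF Z]
  have "tri D K K Z (Id D K) (Zero D K Z) (Zero D Z (SO D K))"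
    using TR1_Id[OF K Z] Id_Hom Zero_Hom SO_Obj K ZO by (simp add: tri_def)
  from tri_rotate[OF this] have s: "tri D K Z (SO D K) (Zero D K Z) (Zero D Z (SO D K)) (Neg D (Id D (SO D K)))"
    using SA_Id[OF K] by simp
  note r = tri_rotate[OF t]
  have b: "Zero D Z C \<in> Hom D Z C" using Zero_Hom ZO tt by blast
  have e: "Zero D Z C \<cdot> Zero D K Z = g \<cdot> u"
    using u(2) Zero_Comp[OF Zero_Hom[OF K ZO] tt(6)] by simp
  obtain c where c: "c \<in> Hom D (SO D K) (SO D A)"
      "SA D u \<cdot> Neg D (Id D (SO D K)) = Neg D (SA D f) \<cdot> c"
    using tri_map[OF s r u(1) b e] by blast
  obtain v where v: "v \<in> Hom D K A" "SA D v = c" using SA_full K tt(4) c(1) by blast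
  have h: "SA D u \<in> Hom D (SO D K) (SO D B)" "SA D f \<cdot> c \<in> Hom D (SO D K) (SO D B)"
    using SA_Hom u(1) tt(1) c(1) Comp_Hom by blast+
  have "Neg D (SA D u) = Neg D (SA D f \<cdot> c)"
    using c(2) Comp_Neg[OF Id_Hom[OF SO_Obj[OF K]] h(1)] Comp_Id[OF h(1)]
      Neg_Comp[OF c(1) SA_Hom[OF tt(1)]] by simp
  then have "SA D u = SA D (f \<cdot> v)" using Neg_inject h SA_Comp[OF v(1) tt(1)] v(2) by metis
  then have "f \<cdot> v = u" using SA_inject[OF u(1) Comp_Hom[OF v(1) tt(1)]] by simp
  with v(1) show thesis by (rule that)
qed

lemma tri_lift_shift:
  assumes t: "tri D A B C f g h" and u: "u \<in> Hom D K (SO D A)" "SA D f \<cdot> u = Zero D K (SO D B)"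
  obtains v where "v \<in> Hom D K C" "h \<cdot> v = u"
proof -
  have "Neg D (SA D f) \<cdot> u = Zero D K (SO D B)"
    using Neg_Comp[OF u(1) SA_Hom[OF triD(1)[OF t]]] u Neg_Zero Hom_Obj SO_Obj triD[OF t] by metis
  then show thesis using tri_lift[OF tri_rotate[OF tri_rotate[OF t]] u(1)] that by blast
qed

text \<open>The shift of \<open>u\<close> lifts through \<open>h\<close> to an arrow from
  \<open>SO D K\<close> to \<open>C\<close>, and such arrows vanish.\<close>

lemma tri_lift_unique:
  assumes t: "tri D A B C f g h" and o: "orth D (SO D K) C"
    and u: "u \<in> Hom D K A" "f \<cdot> u = Zero D K B"
  shows "u = Zero D K A"
proof -
  note tt = triD[OF t]
  have K: "K \<in> Obj D" using Hom_Obj u by blast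
  have "SA D f \<cdot> SA D u = Zero D (SO D K) (SO D B)"
    using SA_Comp[OF u(1) tt(1)] u(2) SA_Zero[OF K tt(5)] by simp
  then obtain v where v: "v \<in> Hom D (SO D K) C" "h \<cdot> v = SA D u"
    using tri_lift_shift[OF t SA_Hom[OF u(1)]] by blast
  then have "SA D u = SA D (Zero D K A)"
    using orthD[OF o v(1)] Comp_Zero[OF tt(3) SO_Obj[OF K]] SA_Zero[OF K tt(4)] by simp
  then show ?thesis using SA_inject[OF u(1) Zero_Hom[OF K tt(4)]] by simp
qed

lemma orth_tri_middle:
  assumes "tri D A B C f g h"
  shows "\<lbrakk>orth D K A; orth D K C\<rbrakk> \<Longrightarrow> orth D K B" "\<lbrakk>orth D A K; orth D C K\<rbrakk> \<Longrightarrow> orth D B K"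
proof -
  note tt = triD[OF assms]
  show "orth D K B" if o: "orth D K A" "orth D K C"
    unfolding orth_def
  proof
    fix u assume u: "u \<in> Hom D K B"
    obtain v where v: "v \<in> Hom D K A" "f \<cdot> v = u"
      using tri_lift[OF assms u orthD[OF o(2) Comp_Hom[OF u tt(2)]]] .
    then show "u = Zero D K B" using orthD[OF o(1) v(1)] Comp_Zero[OF tt(1)] Hom_Obj u by metis
  qed
  show "orth D B K" if o: "orth D A K" "orth D C K"
    unfolding orth_def
  proof
    fix u assume u: "u \<in> Hom D B K"
    obtain v where v: "v \<in> Hom D C K" "v \<cdot> g = u"
      using tri_factor_cone[OF assms u orthD[OF o(1) Comp_Hom[OF tt(1) u]]] .
    then show "u = Zero D B K" using orthD[OF o(2) v(1)] Zero_Comp[OF tt(2)] Hom_Obj u by metis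
  qed
qed

lemma orth_tri_first:
  assumes t: "tri D A B C f g h" and "orth D K B" "orth D (SO D K) C"
  shows "orth D K A"
  unfolding orth_def
  using tri_lift_unique[OF t assms(3)] orthD[OF assms(2) Comp_Hom[OF _ triD(1)[OF t]]] by blast

lemma orth_tri_third:
  assumes "tri D A B C f g h"
  shows "\<lbrakk>orth D K B; orth D K (SO D A)\<rbrakk> \<Longrightarrow> orth D K C"
    "\<lbrakk>orth D B K; orth D (SO D A) K\<rbrakk> \<Longrightarrow> orth D C K"
  using orth_tri_middle[OF tri_rotate[OF assms]] by blast+

lemma tri_SO:
  assumes "tri D A B C f g h" obtains f' g' h' where "tri D (SO D A) (SO D B) (SO D C) f' g' h'"
  using tri_rotate[OF tri_rotate[OF tri_rotate[OF assms]]] by (rule that)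

lemma conflation_iff:
  "conflation D X A f B g C \<longleftrightarrow> A \<in> X \<and> B \<in> X \<and> C \<in> X \<and> (\<exists>h. tri D A B C f g h)"
  unfolding conflation_def tri_def by blast

lemma tri_isomorphic:
  assumes t: "tri D A B C f g h"
  shows "zero_object D C \<Longrightarrow> isomorphic D A B" "zero_object D A \<Longrightarrow> isomorphic D C B"
proof -
  note tt = triD[OF t]
  show "isomorphic D A B" if C: "zero_object D C"
  proof -
    have "g \<cdot> Id D B = Zero D B C" using Comp_Id[OF tt(2)] orthD[OF orth_zero_object(2)[OF C] tt(2)] by simp
    then obtain s where s: "s \<in> Hom D B A" "f \<cdot> s = Id D B" using tri_lift[OF t Id_Hom[OF tt(5)]] by blast
    have "f \<cdot> (s \<cdot> f) = f \<cdot> Id D A"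
      using Comp_assoc[OF tt(1) s(1) tt(1)] s(2) Id_Comp[OF tt(1)] Comp_Id[OF tt(1)] by simp
    \<comment> \<open>\<open>f\<close> is left cancellable by \<open>tri_lift_unique\<close>,
      because arrows into the zero object \<open>C\<close> vanish.\<close>
    then have "s \<cdot> f = Id D A"
      using Comp_inject[OF tt(1) Comp_Hom[OF tt(1) s(1)] Id_Hom[OF tt(4)]]
        tri_lift_unique[OF t orth_zero_object(2)[OF C]] by blast
    then show ?thesis using tt(1) s unfolding isomorphic_def iso_arr_def Hom_def by auto
  qed
  show "isomorphic D C B" if A: "zero_object D A"
  proof -
    have "Id D B \<cdot> f = Zero D A B" using Id_Comp[OF tt(1)] orthD[OF orth_zero_object(1)[OF A] tt(1)] by simp
    then obtain s where s: "s \<in> Hom D C B" "s \<cdot> g = Id D B" using tri_factor_cone[OF t Id_Hom[OF tt(5)]] by blast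
    have SA: "zero_object D (SO D A)" using A zero_object_SO tt by blast
    have "h \<cdot> Id D C = Zero D C (SO D A)"
      using Comp_Id[OF tt(3)] orthD[OF orth_zero_object(2)[OF SA] tt(3)] by simp
    then obtain r where r: "r \<in> Hom D C B" "g \<cdot> r = Id D C"
      using tri_lift[OF tri_rotate[OF t] Id_Hom[OF tt(6)]] by blast
    have "s = r" using Comp_assoc[OF r(1) tt(2) s(1)] s(2) r(2) Comp_Id[OF s(1)] Id_Comp[OF r(1)] by simp
    then show ?thesis using tt(2) s r unfolding isomorphic_def iso_arr_def Hom_def by auto
  qed
qed

end


section \<open>Torsion pairs and generation\<close>

context triangulated_category
begin

lemma storsD:
  assumes "(T, F) \<in> stors D X" "X \<subseteq> Obj D"
  shows "T \<subseteq> X" "F \<subseteq> X" "\<And>A B. \<lbrakk>A \<in> T; B \<in> F\<rbrakk> \<Longrightarrow> orth D A B"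
    "\<And>A B. \<lbrakk>A \<in> T; B \<in> F\<rbrakk> \<Longrightarrow> orth D (SO D A) B"
proof -
  show s: "T \<subseteq> X" "F \<subseteq> X" using assms(1) by (auto simp: stors_def iso_closed_in_def)
  fix A B assume "A \<in> T" "B \<in> F"
  moreover from this have "A \<in> Obj D" "B \<in> Obj D" using s assms(2) by blast+
  ultimately show "orth D A B" "orth D (SO D A) B"
    using assms(1) Ext_vanishes_iff[of A B] by (auto simp: stors_def)
qed

lemma stors_decomposition:
  assumes "(T, F) \<in> stors D X" "Y \<in> X"
  obtains A B f g h where "A \<in> T" "B \<in> F" "tri D A Y B f g h"
proof -
  have "X = star D X T F" using assms(1) by (auto simp: stors_def)
  then have "Y \<in> star D X T F" using assms(2) by simp
  then show thesis using that unfolding star_def conflation_iff by blast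
qed

lemma stors_torsionI:
  assumes t: "(T, F) \<in> stors D X" "X \<subseteq> Obj D" and Y: "Y \<in> X" "\<And>B. B \<in> F \<Longrightarrow> orth D Y B"
  shows "Y \<in> T"
proof -
  obtain A B f g h where d: "A \<in> T" "B \<in> F" "tri D A Y B f g h" using stors_decomposition[OF t(1) Y(1)] .
  have "orth D B B" using orth_tri_third(2)[OF d(3) Y(2)[OF d(2)] storsD(4)[OF t d(1,2)]] .
  then have "isomorphic D A Y" using tri_isomorphic(1)[OF d(3)] orth_self_iff triD(6)[OF d(3)] by blast
  then show ?thesis using t(1) d(1) Y(1) by (auto simp: stors_def iso_closed_in_def)
qed

lemma stors_torsionfreeI:
  assumes t: "(T, F) \<in> stors D X" "X \<subseteq> Obj D" and Y: "Y \<in> X" "\<And>A. A \<in> T \<Longrightarrow> orth D A Y"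
  shows "Y \<in> F"
proof -
  obtain A B f g h where d: "A \<in> T" "B \<in> F" "tri D A Y B f g h" using stors_decomposition[OF t(1) Y(1)] .
  have "orth D A A" using orth_tri_first[OF d(3) Y(2)[OF d(1)] storsD(4)[OF t d(1,2)]] .
  then have "isomorphic D B Y" using tri_isomorphic(2)[OF d(3)] orth_self_iff triD(4)[OF d(3)] by blast
  then show ?thesis using t(1) d(2) Y(1) by (auto simp: stors_def iso_closed_in_def)
qed

lemma coproduct_ex1:
  assumes "is_coproduct D X I M P \<iota>" "Y \<in> X" "\<forall>i \<in> I. \<phi> i \<in> Hom D (M i) Y"
  shows "\<exists>!u. u \<in> Hom D P Y \<and> (\<forall>i \<in> I. u \<cdot> \<iota> i = \<phi> i)"
  using assms by (simp add: is_coproduct_def)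

text \<open>\<open>f\<close> and the zero arrow both restrict to zero on every copy of
  \<open>V\<close>, so they agree by uniqueness.\<close>

lemma coproduct_orth:
  assumes P: "is_coproduct D X I (\<lambda>_. V) P \<iota>" and Y: "Y \<in> X" "f \<in> Hom D P Y"
    and o: "orth D V Y" and V: "V \<in> Obj D"
  shows "f = Zero D P Y"
proof -
  have O: "P \<in> Obj D" "Y \<in> Obj D" using Hom_Obj Y by blast+
  note Z = Zero_Hom[OF O]
  have u: "\<forall>i \<in> I. u \<cdot> \<iota> i = Zero D V Y" if "u \<in> Hom D P Y" for u
    using that P Comp_Hom orthD[OF o] unfolding is_coproduct_def by blast
  have "\<exists>!u. u \<in> Hom D P Y \<and> (\<forall>i \<in> I. u \<cdot> \<iota> i = Zero D V Y)"
    using coproduct_ex1[OF P Y(1), of "\<lambda>_. Zero D V Y"] Zero_Hom[OF V O(2)] by simp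
  then show ?thesis using u Z Y(2) by blast
qed

text \<open>The second map of a presentation is nonzero, so by \<open>coproduct_orth\<close> it
  forces a nonzero arrow from \<open>V\<close> to \<open>Y\<close>.\<close>

lemma Gen_orth:
  assumes "Y \<in> Gen D X V" "orth D V Y" "V \<in> Obj D"
  shows "zero_object D Y"
proof (rule ccontr)
  assume "\<not> zero_object D Y"
  then obtain A P \<iota> e f and I :: "'m set" where "is_coproduct D X I (\<lambda>_. V) P \<iota>" "conflation D X A e P f Y" "f \<noteq> Zero D P Y"
    using assms(1) unfolding Gen_def presentation_def by blast
  then show False using coproduct_orth assms(2,3) unfolding conflation_def by blast
qed

lemma singleton_coproduct:
  assumes "V \<in> X" "V \<in> Obj D" shows "is_coproduct D X {i} (\<lambda>_. V) V (\<lambda>_. Id D V)"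
  unfolding is_coproduct_def using assms Id_Hom Comp_Id by auto

end


section \<open>Intervals of torsion pairs\<close>

text \<open>Here \<open>X\<close> is the heart of \<open>[t\<^sub>1, \<Sigma>\<^sup>-\<^sup>1t\<^sub>2]\<close> and \<open>C\<close> that of \<open>[t\<^sub>1, t\<^sub>2]\<close>.\<close>

locale torsion_interval = triangulated_category D
  for D :: "('o, 'm, 'x) triangulated_data_scheme" (structure) +
  fixes T1 F1 T2 F2 :: "'o set"
  assumes t1: "(T1, F1) \<in> stors D (Obj D)"
    and t2: "(T2, F2) \<in> stors D (Obj D)"
    and T1_sub: "T1 \<subseteq> SO D ` T2"
begin

definition X where "X = {Y \<in> F1. SO D Y \<in> T2}"

definition C where "C = F1 \<inter> T2"

section \<open>Closure properties and the decomposition of objects of \<open>X\<close>\<close>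

lemma T2_Obj: "Y \<in> T2 \<Longrightarrow> Y \<in> Obj D" and F2_Obj: "Y \<in> F2 \<Longrightarrow> Y \<in> Obj D"
  and T1_Obj: "Y \<in> T1 \<Longrightarrow> Y \<in> Obj D" and F1_Obj: "Y \<in> F1 \<Longrightarrow> Y \<in> Obj D"
  using storsD(1,2)[OF t1] storsD(1,2)[OF t2] by auto

lemmas T1I = stors_torsionI[OF t1 subset_refl] and T2I = stors_torsionI[OF t2 subset_refl]
  and F1I = stors_torsionfreeI[OF t1 subset_refl] and F2I = stors_torsionfreeI[OF t2 subset_refl]
  and t1_orth = storsD(3)[OF t1 subset_refl] and t2_orth = storsD(3)[OF t2 subset_refl]
  and t1_orth' = storsD(4)[OF t1 subset_refl] and t2_orth' = storsD(4)[OF t2 subset_refl]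

text \<open>This is the negative extension condition of the second torsion pair.\<close>

lemma SO_T2: "Y \<in> T2 \<Longrightarrow> SO D Y \<in> T2"
  by (rule T2I[OF SO_Obj[OF T2_Obj]]) (assumption, rule t2_orth')

lemma F1_unshift:
  assumes "Y \<in> Obj D" "SO D Y \<in> F1" shows "Y \<in> F1"
proof (rule F1I[OF assms(1)])
  fix A assume A: "A \<in> T1"
  show "orth D A Y" using t1_orth'[OF A assms(2)] orth_SO[OF T1_Obj[OF A] assms(1)] by simp
qed

text \<open>Passing to orthogonals reverses the inclusion \<open>T1_sub\<close>.\<close>

lemma SO_F2: assumes "Z \<in> F2" shows "SO D Z \<in> F1"
proof (rule F1I[OF SO_Obj[OF F2_Obj[OF assms]]])
  fix A assume "A \<in> T1"
  then obtain A' where A': "A' \<in> T2" "A = SO D A'" using T1_sub by blast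
  then show "orth D A (SO D Z)"
    using t2_orth[OF A'(1) assms] orth_SO[OF T2_Obj[OF A'(1)] F2_Obj[OF assms]] by simp
qed

lemma F2_F1: "Z \<in> F2 \<Longrightarrow> Z \<in> F1"
  by (rule F1_unshift[OF F2_Obj SO_F2])

lemma X_Obj: "Y \<in> X \<Longrightarrow> Y \<in> Obj D" "X \<subseteq> Obj D"
  using F1_Obj by (auto simp: X_def)

lemma C_X: "Y \<in> C \<Longrightarrow> Y \<in> X" "C \<subseteq> X"
  using SO_T2 by (auto simp: C_def X_def)

lemma C_Obj: "Y \<in> C \<Longrightarrow> Y \<in> Obj D"
  using C_X X_Obj by blast

lemma C_unshift: "\<lbrakk>Y \<in> Obj D; SO D Y \<in> C\<rbrakk> \<Longrightarrow> Y \<in> X"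
  using F1_unshift by (auto simp: C_def X_def)

lemma T2_extension: "\<lbrakk>tri D A B E f g h; A \<in> T2; E \<in> T2\<rbrakk> \<Longrightarrow> B \<in> T2"
  by (rule T2I) (auto intro: triD orth_tri_middle t2_orth)

lemma T2_cone: "\<lbrakk>tri D A B E f g h; SO D A \<in> T2; B \<in> T2\<rbrakk> \<Longrightarrow> E \<in> T2"
  using T2_extension[OF tri_rotate] by blast

lemma F1_extension: "\<lbrakk>tri D A B E f g h; A \<in> F1; E \<in> F1\<rbrakk> \<Longrightarrow> B \<in> F1"
  by (rule F1I) (auto intro: triD orth_tri_middle t1_orth)

lemma X_extension: assumes "tri D A B E f g h" "A \<in> X" "E \<in> X" shows "B \<in> X"
proof -
  obtain f' g' h' where "tri D (SO D A) (SO D B) (SO D E) f' g' h'" using tri_SO[OF assms(1)] .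
  then show ?thesis using T2_extension F1_extension[OF assms(1)] assms(2,3) by (auto simp: X_def)
qed

lemma zero_C: assumes "zero_object D Z" shows "Z \<in> C"
  using assms F1I[OF zero_object_Obj] T2I[OF zero_object_Obj] orth_zero_object by (simp add: C_def)

text \<open>The decomposition by \<open>t2\<close> stays in \<open>X\<close>: \<open>A\<close>
  inherits \<open>F1\<close> from \<open>Y\<close> and \<open>B\<close>, and \<open>SO D B\<close>
  lies in \<open>T2\<close> as third term of the shifted triangle. Having \<open>SO D B\<close> in
  \<open>C\<close> allows \<open>B\<close> to be tested by first extensions from
  \<open>V\<close>.\<close>

lemma X_decomposition:
  assumes Y: "Y \<in> X"
  obtains A B f g h where "A \<in> C" "B \<in> F2" "B \<in> X" "SO D B \<in> C" "tri D A Y B f g h"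
proof -
  obtain A B f g h where d: "A \<in> T2" "B \<in> F2" "tri D A Y B f g h"
    using stors_decomposition[OF t2 X_Obj(1)[OF Y]] .
  have "A \<in> F1"
    using F1I[OF triD(4)[OF d(3)]] orth_tri_first[OF d(3)] t1_orth t1_orth' Y F2_F1[OF d(2)]
    by (auto simp: X_def)
  moreover obtain f' g' h' where s: "tri D (SO D A) (SO D Y) (SO D B) f' g' h'" using tri_SO[OF d(3)] .
  have "SO D B \<in> T2" using T2_cone[OF s] SO_T2 d(1) Y by (simp add: X_def)
  ultimately show thesis using that d SO_F2 F2_F1 by (auto simp: C_def X_def)
qed

section \<open>Copowers, presentations and \<open>Gen\<close> in \<open>X\<close> and in
  \<open>C\<close>\<close>

text \<open>Presentations in \<open>X\<close> and in \<open>C\<close> can be compared only if they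
  use the same copowers.\<close>

lemma coproduct_X_C:
  assumes V: "V \<in> C"
  shows "is_coproduct D X I (\<lambda>_. V) P \<iota> \<longleftrightarrow> is_coproduct D C I (\<lambda>_. V) P \<iota>"
proof
  assume P: "is_coproduct D X I (\<lambda>_. V) P \<iota>"
  then have PX: "P \<in> X" by (simp add: is_coproduct_def)
  obtain A B f g h where d: "A \<in> C" "B \<in> F2" "B \<in> X" "tri D A P B f g h" using X_decomposition[OF PX] .
  note dd = triD[OF d(4)]
  \<comment> \<open>\<open>V\<close> has no nonzero arrow to \<open>B\<close>, so neither has
    \<open>P\<close>; arrows from \<open>P\<close> to \<open>F2\<close> factor through
    \<open>g\<close> and vanish.\<close>
  have g: "g = Zero D P B"
    using coproduct_orth[OF P d(3) dd(2) t2_orth[OF _ d(2)] C_Obj[OF V]] V by (simp add: C_def)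
  have "P \<in> T2"
  proof (rule T2I)
    show "orth D P N" if N: "N \<in> F2" for N
      unfolding orth_def
    proof
      fix u assume u: "u \<in> Hom D P N"
      have "orth D A N" using t2_orth N d(1) by (simp add: C_def)
      then obtain v where "v \<in> Hom D B N" "v \<cdot> g = u"
        using tri_factor_cone[OF d(4) u] orthD Comp_Hom[OF dd(1) u] by blast
      then show "u = Zero D P N" using g Comp_Zero dd(5) by metis
    qed
  qed (rule dd)
  then have "P \<in> C" using PX by (simp add: C_def X_def)
  then show "is_coproduct D C I (\<lambda>_. V) P \<iota>"
    unfolding is_coproduct_def using P coproduct_ex1[OF P C_X(1)] by (simp add: is_coproduct_def)
next
  assume P: "is_coproduct D C I (\<lambda>_. V) P \<iota>"
  then have PC: "P \<in> C" and i: "\<And>i. i \<in> I \<Longrightarrow> \<iota> i \<in> Hom D V P" by (auto simp: is_coproduct_def)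
  show "is_coproduct D X I (\<lambda>_. V) P \<iota>"
    unfolding is_coproduct_def
  proof (intro conjI ballI allI impI)
    show "P \<in> X" using PC C_X by blast
    fix Y \<phi> assume Y: "Y \<in> X" and \<phi>: "\<forall>i \<in> I. \<phi> i \<in> Hom D V Y"
    obtain A B f g h where d: "A \<in> C" "B \<in> F2" "tri D A Y B f g h" using X_decomposition[OF Y] .
    note dd = triD[OF d(3)]
    \<comment> \<open>Arrows from \<open>C\<close> to \<open>Y\<close> lift to the torsion part
      \<open>A\<close>, which carries the universal property from \<open>A\<close> over to
      \<open>Y\<close>.\<close>
    have lift: "\<exists>v \<in> Hom D K A. f \<cdot> v = u" if "K \<in> C" "u \<in> Hom D K Y" for K u
    proof -
      have "orth D K B" using that(1) d(2) t2_orth by (simp add: C_def)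
      then have "g \<cdot> u = Zero D K B" using orthD Comp_Hom[OF that(2) dd(2)] by blast
      then show ?thesis using tri_lift[OF d(3) that(2)] by blast
    qed
    have o: "orth D (SO D V) B" using t2_orth' d(2) V by (simp add: C_def)
    \<comment> \<open>Cancelling \<open>f\<close> on arrows from \<open>V\<close> suffices: on
      \<open>P\<close>, uniqueness comes from the coproduct in \<open>C\<close>.\<close>
    have inj: "x = y" if "x \<in> Hom D V A" "y \<in> Hom D V A" "f \<cdot> x = f \<cdot> y" for x y
      by (rule Comp_inject[OF dd(1) that]) (rule tri_lift_unique[OF d(3) o])
    have "\<forall>i \<in> I. \<exists>x. x \<in> Hom D V A \<and> f \<cdot> x = \<phi> i" using lift[OF V] \<phi> by blast
    from bchoice[OF this] obtain \<psi>
      where \<psi>: "\<And>i. i \<in> I \<Longrightarrow> \<psi> i \<in> Hom D V A \<and> f \<cdot> \<psi> i = \<phi> i" by blast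
    then have ex1: "\<exists>!u. u \<in> Hom D P A \<and> (\<forall>i \<in> I. u \<cdot> \<iota> i = \<psi> i)"
      using coproduct_ex1[OF P d(1), of \<psi>] by simp
    then obtain u where u: "u \<in> Hom D P A" "\<forall>i \<in> I. u \<cdot> \<iota> i = \<psi> i" by blast
    show "\<exists>!w. w \<in> Hom D P Y \<and> (\<forall>i \<in> I. w \<cdot> \<iota> i = \<phi> i)"
    proof (rule ex1I[of _ "f \<cdot> u"])
      show "f \<cdot> u \<in> Hom D P Y \<and> (\<forall>i \<in> I. (f \<cdot> u) \<cdot> \<iota> i = \<phi> i)"
        using Comp_Hom[OF u(1) dd(1)] Comp_assoc[OF i u(1) dd(1)] u(2) \<psi> by simp
      fix w assume w: "w \<in> Hom D P Y \<and> (\<forall>i \<in> I. w \<cdot> \<iota> i = \<phi> i)"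
      then obtain w' where w': "w' \<in> Hom D P A" "f \<cdot> w' = w" using lift[OF PC] by blast
      have "w' \<cdot> \<iota> j = \<psi> j" if "j \<in> I" for j
        using inj[OF Comp_Hom[OF i[OF that] w'(1)]] \<psi>[OF that] Comp_assoc[OF i[OF that] w'(1) dd(1)]
          w w'(2) that by simp
      then have "w' = u" using ex1 u w'(1) by blast
      then show "w = f \<cdot> u" using w'(2) by simp
    qed
  qed (rule i)
qed

lemma presentation_C_X:
  assumes "V \<in> C" "presentation D C V A Y" shows "presentation D X V A Y"
  using assms(2) coproduct_X_C[OF assms(1)] C_X unfolding presentation_def conflation_def by blast

text \<open>A conflation in \<open>C\<close> has its first term in \<open>C\<close>; the condition
  \<open>Gen = Pres\<close> will provide such an \<open>A\<close>.\<close>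

lemma presentation_X_C:
  assumes "V \<in> C" "presentation D X V A Y" "A \<in> C" "Y \<in> C" shows "presentation D C V A Y"
proof -
  obtain I :: "'m set" and P \<iota> e f where p: "is_coproduct D X I (\<lambda>_. V) P \<iota>" "conflation D X A e P f Y" "f \<noteq> Zero D P Y"
    using assms(2) unfolding presentation_def by blast
  have "is_coproduct D C I (\<lambda>_. V) P \<iota>" using p(1) coproduct_X_C[OF assms(1)] by blast
  moreover from this have "conflation D C A e P f Y"
    using p(2) assms(3,4) by (simp add: conflation_def is_coproduct_def)
  ultimately show ?thesis using p(3) unfolding presentation_def by blast
qed

text \<open>For \<open>A\<close> in \<open>X\<close> the object \<open>SO D A\<close> is in
  \<open>T2\<close>, so \<open>Y\<close> is an extension of it by the copower \<open>P\<close>, both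
  in \<open>T2\<close>.\<close>

lemma Gen_X_sub:
  assumes V: "V \<in> C" shows "Gen D X V \<subseteq> C"
proof
  fix Y assume "Y \<in> Gen D X V"
  then consider "zero_object D Y" | A where "Y \<in> X" "presentation D X V A Y" by (auto simp: Gen_def)
  then show "Y \<in> C"
  proof cases
    case 2
    then obtain I :: "'m set" and P \<iota> e f where p: "is_coproduct D X I (\<lambda>_. V) P \<iota>" "conflation D X A e P f Y"
      unfolding presentation_def by blast
    have "P \<in> C" using p(1) coproduct_X_C[OF V] by (auto simp: is_coproduct_def)
    moreover obtain h where "tri D A P Y e f h" "A \<in> X" using p(2) unfolding conflation_iff by blast
    ultimately have "Y \<in> T2" using T2_cone by (auto simp: C_def X_def)
    then show ?thesis using 2 by (simp add: C_def X_def)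
  qed (rule zero_C)
qed

lemma stors_C: "(C, F2 \<inter> X) \<in> stors D X"
proof -
  have "B \<in> C" if A: "A \<in> C" and B: "B \<in> X" and i: "isomorphic D A B" for A B
  proof -
    have "A \<in> T2" using A by (simp add: C_def)
    have "B \<in> T2"
    proof (rule T2I[OF X_Obj(1)[OF B]])
      fix N assume "N \<in> F2"
      show "orth D B N" by (rule orth_isomorphic(1)[OF i t2_orth]) fact+
    qed
    then show ?thesis using B by (simp add: C_def X_def)
  qed
  then have "iso_closed_in D X C" unfolding iso_closed_in_def using C_X(2) by blast
  moreover have "B \<in> F2" if A: "A \<in> F2" and B: "B \<in> X" and i: "isomorphic D A B" for A B
  proof (rule F2I[OF X_Obj(1)[OF B]])
    fix N assume "N \<in> T2"
    show "orth D N B" by (rule orth_isomorphic(2)[OF i t2_orth]) fact+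
  qed
  then have "iso_closed_in D X (F2 \<inter> X)" unfolding iso_closed_in_def by blast
  moreover have "Ext_vanishes D 0 A B \<and> Ext_vanishes D (-1) A B" if A: "A \<in> C" and B: "B \<in> F2" for A B
  proof -
    have "A \<in> T2" using A by (simp add: C_def)
    then show ?thesis
      using Ext_vanishes_iff(1,3)[OF C_Obj[OF A] F2_Obj[OF B]] t2_orth t2_orth' B by simp
  qed
  moreover have "X = star D X C (F2 \<inter> X)"
  proof
    show "X \<subseteq> star D X C (F2 \<inter> X)"
    proof
      fix Y assume Y: "Y \<in> X"
      obtain A B f g h where d: "A \<in> C" "B \<in> F2" "B \<in> X" "tri D A Y B f g h" using X_decomposition[OF Y] .
      then have "conflation D X A f Y g B" using C_X(1) Y unfolding conflation_iff by blast
      then show "Y \<in> star D X C (F2 \<inter> X)" using d unfolding star_def by blast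
    qed
  qed (auto simp: star_def conflation_def)
  ultimately show ?thesis by (simp add: stors_def)
qed

text \<open>For \<open>Y\<close> in \<open>T2\<close>, the torsion-free part of
  \<open>SO D Y\<close> with respect to \<open>t1\<close> is again a shift of an object of
  \<open>T2\<close>, hence zero by assumption. Orthogonality then gives the second equality.\<close>

lemma t1_eq:
  assumes 0: "\<And>M. \<lbrakk>M \<in> T2; SO D M \<in> F1\<rbrakk> \<Longrightarrow> zero_object D (SO D M)"
  shows "T1 = SO D ` T2" "F1 = SO D ` F2"
proof -
  have T: "SO D Y \<in> T1" if Y: "Y \<in> T2" for Y
  proof -
    have YO: "SO D Y \<in> Obj D" using Y T2_Obj SO_Obj by blast
    obtain K Z f g h where d: "K \<in> T1" "Z \<in> F1" "tri D K (SO D Y) Z f g h"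
      using stors_decomposition[OF t1 YO] .
    obtain Z' where Z': "Z' \<in> Obj D" "SO D Z' = Z" using SO_surj triD(6)[OF d(3)] by blast
    obtain K' where K': "K' \<in> T2" "SO D K' = K" using T1_sub d(1) by blast
    have "Z' \<in> T2"
    proof (rule T2I[OF Z'(1)])
      fix N assume N: "N \<in> F2"
      note NO = F2_Obj[OF N]
      have "orth D (SO D Y) (SO D N)" using t2_orth[OF Y N] orth_SO[OF T2_Obj[OF Y] NO] by simp
      \<comment> \<open>\<open>K\<close> is itself the shift of \<open>K'\<close> in
        \<open>T2\<close>, so this is the negative extension condition for \<open>K'\<close> and
        \<open>N\<close>, shifted once.\<close>
      moreover have "orth D (SO D K) (SO D N)"
        using t2_orth'[OF K'(1) N] orth_SO[OF SO_Obj[OF T2_Obj[OF K'(1)]] NO] K'(2) by simp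
      ultimately have "orth D Z (SO D N)" using orth_tri_third(2)[OF d(3)] by blast
      then show "orth D Z' N" using orth_SO[OF Z'(1) NO] Z'(2) by simp
    qed
    then have Z0: "zero_object D Z" using 0 Z'(2) d(2) by blast
    show ?thesis
      by (rule T1I[OF YO]) (rule orth_tri_middle(2)[OF d(3) t1_orth[OF d(1)] orth_zero_object(1)[OF Z0]])
  qed
  then show "T1 = SO D ` T2" using T1_sub by blast
  have "N \<in> SO D ` F2" if N: "N \<in> F1" for N
  proof -
    obtain N' where N': "N' \<in> Obj D" "SO D N' = N" using SO_surj[OF F1_Obj[OF N]] by blast
    have "N' \<in> F2"
    proof (rule F2I[OF N'(1)])
      fix Y assume Y: "Y \<in> T2"
      show "orth D Y N'" using t1_orth[OF T[OF Y] N] orth_SO[OF T2_Obj[OF Y] N'(1)] N'(2) by simp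
    qed
    then show ?thesis using N'(2) by blast
  qed
  then show "F1 = SO D ` F2" using SO_F2 by blast
qed

section \<open>Projective generators of \<open>C\<close>\<close>

lemma generator_orth:
  assumes "generator D C V" "Y \<in> C" "orth D V Y" shows "zero_object D Y"
  using Gen_orth[of Y C V] assms C_Obj by (simp add: generator_def)

lemma projective_iff: "projective D C V \<longleftrightarrow> V \<in> C \<and> (\<forall>Y \<in> C. orth D V (SO D Y))"
  unfolding projective_def using Ext_vanishes_iff(2) C_Obj by blast

lemma projective_generator_t1:
  assumes "projective_generator D C V"
  shows "T1 = SO D ` T2" "F1 = SO D ` F2"
proof -
  have *: "zero_object D (SO D M)" if "M \<in> T2" "SO D M \<in> F1" for M
  proof -
    have M: "M \<in> C" "SO D M \<in> C" using that F1_unshift T2_Obj SO_T2 by (auto simp: C_def)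
    have "generator D C V" "orth D V (SO D M)"
      using assms M(1) by (auto simp: projective_generator_def projective_iff)
    then show ?thesis using generator_orth M(2) by blast
  qed
  show "T1 = SO D ` T2" "F1 = SO D ` F2" by (rule t1_eq[OF *], assumption+)+
qed

text \<open>An element of \<open>Hom(V, \<Sigma>\<^sup>2A)\<close> classifies an extension \<open>E\<close> of \<open>\<Sigma>\<^sup>-\<^sup>1V\<close> by \<open>A\<close>, which lies in \<open>X\<close>.
  Embedding \<open>E\<close> into an object of \<open>C\<close>, the octahedral axiom factors the element through \<open>\<Sigma>Q\<close> with \<open>Q\<close> in \<open>C\<close>.\<close>

lemma projective_second_ext:
  assumes p: "projective D C V" and c: "cogenerating D X C" and A: "A \<in> C"
  shows "orth D V (SO D (SO D A))"
  unfolding orth_def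
proof
  fix u assume u: "u \<in> Hom D V (SO D (SO D A))"
  have V: "V \<in> C" using p by (simp add: projective_iff)
  obtain V' where V': "V' \<in> Obj D" "SO D V' = V" using SO_surj C_Obj[OF V] by blast
  note AO = C_Obj[OF A]
  obtain u' where u': "u' \<in> Hom D V' (SO D A)" "SA D u' = u"
    using SA_full[OF V'(1) SO_Obj[OF AO]] u V'(2) by blast
  obtain E f g where t: "tri D A E V' f g u'" using tri_third[OF u'(1) AO] .
  have V'X: "V' \<in> X" using C_unshift V' V by simp
  have "E \<in> X" using X_extension[OF t C_X(1)[OF A] V'X] .
  then obtain S Y s r where "S \<in> C" "conflation D X E s S r Y" using c unfolding cogenerating_def by blast
  then obtain h where S: "S \<in> C" "Y \<in> X" "tri D E S Y s r h" unfolding conflation_iff by blast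
  note tt = triD[OF t] and ss = triD[OF S(3)]
  have sf: "s \<cdot> f \<in> Hom D A S" using Comp_Hom tt(1) ss(1) by blast
  obtain Q k' k'' where Q: "tri D A S Q (s \<cdot> f) k' k''" using tri_cone[OF sf] .
  \<comment> \<open>The octahedron on \<open>s \<cdot> f\<close> has cones \<open>V'\<close>,
    \<open>Y\<close> and \<open>Q\<close>; \<open>k'' \<cdot> p' = u'\<close> is the factorisation
    through \<open>Q\<close>.\<close>
  obtain p' q where pq: "p' \<in> Hom D V' Q" "q \<in> Hom D Q Y" "(p', q, SA D g \<cdot> h) \<in> Dist D" "k'' \<cdot> p' = u'"
    using TR4[of f A E s S g u' V' r h Y k' k'' Q] t S(3) Q unfolding tri_def by blast
  have "tri D V' Q Y p' q (SA D g \<cdot> h)"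
    using pq Comp_Hom[OF ss(3) SA_Hom[OF tt(2)]] by (simp add: tri_def)
  \<comment> \<open>\<open>Q\<close> is in \<open>F1\<close> as an extension of \<open>Y\<close> by
    \<open>V'\<close>, and in \<open>T2\<close> as the cone of an arrow from \<open>A\<close> to
    \<open>S\<close>.\<close>
  then have "Q \<in> F1" using F1_extension V'X S(2) by (simp add: X_def)
  moreover have "Q \<in> T2" using T2_cone[OF Q] A S(1) SO_T2 by (simp add: C_def)
  ultimately have "Q \<in> C" by (simp add: C_def)
  then have "orth D V (SO D Q)" using p by (simp add: projective_iff)
  then have "SA D p' = Zero D V (SO D Q)" using orthD SA_Hom[OF pq(1)] V'(2) by simp
  moreover have "u = SA D k'' \<cdot> SA D p'" using SA_Comp[OF pq(1) triD(3)[OF Q]] pq(4) u'(2) by simp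
  ultimately show "u = Zero D V (SO D (SO D A))"
    using Comp_Zero[OF SA_Hom[OF triD(3)[OF Q]] C_Obj[OF V]] by simp
qed

lemma projective_generator_perp_1:
  assumes "projective_generator D C V" "cogenerating D X C"
  shows "perp D X 1 V = C"
proof
  have p: "projective D C V" and g: "generator D C V" using assms(1) by (auto simp: projective_generator_def)
  then have V: "V \<in> C" by (simp add: projective_iff)
  show "C \<subseteq> perp D X 1 V" using p C_X by (auto simp: perp_def projective_def)
  show "perp D X 1 V \<subseteq> C"
  proof
    fix Y assume "Y \<in> perp D X 1 V"
    then have Y: "Y \<in> X" "orth D V (SO D Y)"
      using Ext_vanishes_iff(2)[OF C_Obj[OF V] X_Obj(1)] by (auto simp: perp_def)
    obtain A B f g' h where d: "A \<in> C" "SO D B \<in> C" "tri D A Y B f g' h" using X_decomposition[OF Y(1)] .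
    obtain f' g'' h' where s: "tri D (SO D A) (SO D Y) (SO D B) f' g'' h'" using tri_SO[OF d(3)] .
    \<comment> \<open>Hom(V,\<Sigma>B) sits between Hom(V,\<Sigma>Y) and Hom(V,\<Sigma>\<Sigma>A),
      which both vanish.\<close>
    have "orth D V (SO D B)"
      using orth_tri_third(1)[OF s Y(2) projective_second_ext[OF p assms(2) d(1)]] .
    then have "zero_object D B" using generator_orth[OF g d(2)] zero_object_SO triD(6)[OF d(3)] by blast
    then have "B \<in> C" by (rule zero_C)
    then show "Y \<in> C" using T2_extension[OF d(3)] d(1) Y(1) by (simp add: C_def X_def)
  qed
qed

lemma generator_perp_0:
  assumes V: "V \<in> C" and g: "generator D C V"
  shows "perp D X 0 V = F2 \<inter> X"
proof
  note VO = C_Obj[OF V]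
  show "F2 \<inter> X \<subseteq> perp D X 0 V"
    using V Ext_vanishes_iff(1)[OF VO X_Obj(1)] t2_orth by (auto simp: perp_def C_def)
  show "perp D X 0 V \<subseteq> F2 \<inter> X"
  proof
    fix Y assume "Y \<in> perp D X 0 V"
    then have Y: "Y \<in> X" "orth D V Y" using Ext_vanishes_iff(1)[OF VO X_Obj(1)] by (auto simp: perp_def)
    obtain A B f g' h where d: "A \<in> C" "B \<in> F2" "tri D A Y B f g' h" using X_decomposition[OF Y(1)] .
    \<comment> \<open>Hom(V,A) embeds into Hom(V,Y) because Hom(\<Sigma>V,B) = 0.\<close>
    have "orth D V A" using orth_tri_first[OF d(3) Y(2)] t2_orth' V d(2) by (simp add: C_def)
    then have "zero_object D A" using generator_orth[OF g d(1)] by blast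
    then have "Y \<in> F2"
      using F2I[OF X_Obj(1)[OF Y(1)]] orth_tri_middle(1)[OF d(3)] orth_zero_object(2) t2_orth d(2) by blast
    then show "Y \<in> F2 \<inter> X" using Y(1) by blast
  qed
qed

lemma projective_generator_extended_tilting:
  assumes pg: "projective_generator D C V" and c: "cogenerating D X C"
  shows "extended_tilting D X V" "Gen D X V = perp D X 1 V"
proof -
  have V: "V \<in> C" and g: "generator D C V" using pg by (auto simp: projective_generator_def generator_def)
  \<comment> \<open>Conflations in \<open>C\<close> have first term in \<open>C\<close>, so the same
    presentations will serve for both \<open>Gen\<close> and \<open>Pres\<close>.\<close>
  have C: "Y \<in> C \<Longrightarrow> zero_object D Y \<or> (\<exists>A \<in> C. presentation D C V A Y)" for Y
    using g unfolding generator_def Gen_def presentation_def conflation_def by blast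
  have Gen: "Gen D X V = C"
    using Gen_X_sub[OF V] C presentation_C_X[OF V] C_X unfolding Gen_def by blast
  have "Pres D X V \<subseteq> Gen D X V" by (auto simp: Pres_def Gen_def)
  moreover have "C \<subseteq> Pres D X V"
    using C presentation_C_X[OF V] C_X unfolding Pres_def Gen by blast
  ultimately have "Pres D X V = C" using Gen by blast
  then show "extended_tilting D X V"
    using V C_X stors_C generator_perp_0[OF V g] projective_generator_perp_1[OF pg c] Gen c
    by (simp add: extended_tilting_def)
  show "Gen D X V = perp D X 1 V" using Gen projective_generator_perp_1[OF pg c] by simp
qed

text \<open>For \<open>Y\<close> in \<open>C\<close> there is a conflation \<open>\<Sigma>\<^sup>-\<^sup>1Y \<rightarrow> V \<rightarrow> V \<oplus> Y\<close> in \<open>X\<close>; its second map is nonzero,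
  so \<open>V \<oplus> Y\<close> lies in \<open>Gen V\<close>.\<close>

lemma extended_tilting_C_sub:
  assumes a: "extended_tilting D X V" and nz: "\<not> zero_object D V"
  shows "C \<subseteq> Gen D X V"
proof
  fix Y assume Y: "Y \<in> C"
  have V: "V \<in> X" and t: "(Gen D X V, perp D X 0 V) \<in> stors D X" using a by (auto simp: extended_tilting_def)
  note VO = X_Obj(1)[OF V] and YO = C_Obj[OF Y]
  obtain Y' where Y': "Y' \<in> Obj D" "SO D Y' = Y" using SO_surj YO by blast
  \<comment> \<open>The zero class gives the split extension \<open>E\<close> of \<open>Y\<close> by
    \<open>V\<close>.\<close>
  obtain E f g where e: "tri D V E Y f g (Zero D Y (SO D V))"
    using tri_third[OF Zero_Hom[OF YO SO_Obj[OF VO]] VO] .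
  note ee = triD[OF e]
  obtain k where k: "tri D Y' V E k f g" using tri_rotate_back[of V E Y' f g] e Y' by metis
  have E: "E \<in> X" using X_extension[OF e V C_X(1)[OF Y]] .
  have Y'X: "Y' \<in> X" using C_unshift Y Y' by simp
  have "f \<noteq> Zero D V E"
  proof
    assume f: "f = Zero D V E"
    let ?I = "Id D (SO D V)"
    have I: "?I \<in> Hom D (SO D V) (SO D V)" using Id_Hom SO_Obj VO by blast
    have "SA D f \<cdot> ?I = Zero D (SO D V) (SO D E)"
      using f SA_Zero[OF VO ee(5)] Zero_Comp[OF I SO_Obj[OF ee(5)]] by simp
    \<comment> \<open>The identity of \<open>SO D V\<close> lifts through the zero third arrow,
      which would make \<open>V\<close> zero.\<close>
    then obtain v where v: "v \<in> Hom D (SO D V) Y" "Zero D Y (SO D V) \<cdot> v = ?I"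
      using tri_lift_shift[OF e I] by blast
    then have "zero_object D (SO D V)"
      using Zero_Comp[OF v(1) SO_Obj[OF VO]] SO_Obj[OF VO] by (simp add: zero_object_iff)
    then show False using nz zero_object_SO[OF VO] by simp
  qed
  moreover have "conflation D X Y' k V f E" unfolding conflation_iff using k Y'X V E by blast
  ultimately have "presentation D X V Y' E"
    unfolding presentation_def using singleton_coproduct[OF V VO, of "Id D V"] by blast
  then have EG: "E \<in> Gen D X V" using E by (auto simp: Gen_def)
  \<comment> \<open>A section of \<open>g\<close> makes \<open>Y\<close> a retract of
    \<open>E\<close>, and torsion passes to retracts.\<close>
  have "Zero D Y (SO D V) \<cdot> Id D Y = Zero D Y (SO D V)" using Comp_Id[OF ee(3)] .
  then obtain s where s: "s \<in> Hom D Y E" "g \<cdot> s = Id D Y"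
    using tri_lift[OF tri_rotate[OF e] Id_Hom[OF YO]] by blast
  show "Y \<in> Gen D X V"
    by (rule stors_torsionI[OF t X_Obj(2) C_X(1)[OF Y]])
      (rule orth_retract(1)[OF s(1) ee(2) s(2) storsD(3)[OF t X_Obj(2) EG]])
qed

lemma extended_tilting_projective_generator:
  assumes a: "extended_tilting D X V" and nz: "\<not> zero_object D V"
  shows "cogenerating D X C" "projective_generator D C V"
proof -
  let ?G = "Gen D X V"
  have V: "V \<in> X" and t: "(?G, perp D X 0 V) \<in> stors D X" and pres: "?G = Pres D X V"
    and G1: "?G \<subseteq> perp D X 1 V" and cog: "cogenerating D X ?G"
    using a by (auto simp: extended_tilting_def)
  note CG = extended_tilting_C_sub[OF a nz]
  note VO = X_Obj(1)[OF V]
  have p: "orth D V (SO D Y)" if "Y \<in> ?G" for Y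
    using G1 that Ext_vanishes_iff(2)[OF VO X_Obj(1)] by (auto simp: perp_def)
  obtain A B f g h where d: "A \<in> C" "B \<in> X" "SO D B \<in> C" "tri D A V B f g h" using X_decomposition[OF V] .
  \<comment> \<open>Arrows from \<open>B\<close> to \<open>N\<close> are controlled by those from
    \<open>V\<close>, zero by choice of \<open>N\<close>, and those from \<open>SO D A\<close>, zero
    because \<open>A\<close> lies in \<open>C\<close>, hence in \<open>?G\<close>.\<close>
  have "B \<in> ?G"
  proof (rule stors_torsionI[OF t X_Obj(2) d(2)])
    fix N assume N: "N \<in> perp D X 0 V"
    then have "orth D V N" using Ext_vanishes_iff(1)[OF VO X_Obj(1)] by (auto simp: perp_def)
    moreover have "orth D (SO D A) N" using storsD(4)[OF t X_Obj(2)] CG d(1) N by blast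
    ultimately show "orth D B N" using orth_tri_third(2)[OF d(4)] by blast
  qed
  \<comment> \<open>\<open>B\<close> in \<open>?G\<close> gives Hom(V,\<Sigma>B) = 0, while
    \<open>SO D B\<close> in \<open>C\<close> lies in \<open>?G\<close> and is detected by
    \<open>V\<close>.\<close>
  then have "zero_object D (SO D B)" using Gen_orth[OF _ p VO] CG d(3) by blast
  then have "B \<in> C" using zero_C zero_object_SO triD(6)[OF d(4)] by blast
  then have VC: "V \<in> C" using T2_extension[OF d(4)] d(1) V by (simp add: C_def X_def)
  have G: "?G = C" using CG Gen_X_sub[OF VC] by blast
  show "cogenerating D X C" using cog G by simp
  have "C \<subseteq> Gen D C V"
  proof
    fix Y assume Y: "Y \<in> C"
    \<comment> \<open>\<open>Pres\<close> supplies a first term in \<open>?G\<close>, that is in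
      \<open>C\<close>, so the presentation descends to \<open>C\<close>.\<close>
    then have "zero_object D Y \<or> (\<exists>A \<in> C. presentation D X V A Y)" using pres G unfolding Pres_def by blast
    then show "Y \<in> Gen D C V" using presentation_X_C[OF VC] Y unfolding Gen_def by blast
  qed
  then have "generator D C V" using VC by (auto simp: generator_def Gen_def)
  then show "projective_generator D C V"
    using p G VC by (simp add: projective_generator_def projective_iff)
qed

text \<open>Covers zero \<open>V\<close>, for which the argument through \<open>V \<oplus> Y\<close>
  breaks down because its map is zero.\<close>

lemma zero_projective_generator:
  assumes V: "zero_object D V" and 0: "\<And>Y. Y \<in> X \<Longrightarrow> zero_object D Y"
  shows "cogenerating D X C" "projective_generator D C V"
proof -
  have "\<exists>B \<in> C. \<exists>Y' f g. conflation D X Y f B g Y'" if "Y \<in> X" for Y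
  proof -
    note Z = 0[OF that]
    note ZO = zero_object_Obj[OF Z]
    have "conflation D X Y (Id D Y) Y (Zero D Y Y) Y"
      unfolding conflation_def using TR1_Id[OF ZO Z] that Id_Hom Zero_Hom ZO SO_Obj by blast
    then show ?thesis using zero_C[OF Z] by blast
  qed
  then show "cogenerating D X C" using C_X by (auto simp: cogenerating_def)
  have "Gen D C V = C" using 0 C_X by (auto simp: Gen_def)
  then show "projective_generator D C V"
    using zero_C[OF V] orth_zero_object(1)[OF V]
    by (simp add: projective_generator_def generator_def projective_iff)
qed

end

theorem theorem5p21:
  fixes D :: "('o, 'm, 'x) triangulated_data_scheme"
    and t\<^sub>1 t\<^sub>2 t\<^sub>3 :: "'o set \<times> 'o set"
    and V :: 'o
  assumes "triangulated_category D"
    and "t\<^sub>1 \<in> stors D (Obj D)" and "t\<^sub>2 \<in> stors D (Obj D)" and "t\<^sub>3 \<in> stors D (Obj D)"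
    and "stors_le t\<^sub>1 t\<^sub>2" and "stors_le t\<^sub>2 t\<^sub>3"
    and "stors_le t\<^sub>1 (shift_pair D 1 t\<^sub>2)"
    and "t\<^sub>3 = shift_pair D (-1) t\<^sub>2"
    and "V \<in> heart t\<^sub>1 t\<^sub>3"
    and nondegenerate: "zero_object D V \<Longrightarrow> \<forall>Y \<in> heart t\<^sub>1 t\<^sub>3. zero_object D Y"
  defines "a \<equiv> extended_tilting D (heart t\<^sub>1 t\<^sub>3) V"
    and "b \<equiv> extended_tilting D (heart t\<^sub>1 t\<^sub>3) V \<and>
               Gen D (heart t\<^sub>1 t\<^sub>3) V = perp D (heart t\<^sub>1 t\<^sub>3) 1 V"
    and "c \<equiv> cogenerating D (heart t\<^sub>1 t\<^sub>3) (heart t\<^sub>1 t\<^sub>2) \<and>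
               projective_generator D (heart t\<^sub>1 t\<^sub>2) V"
  shows "(a \<longleftrightarrow> b) \<and> (b \<longleftrightarrow> c) \<and> (a \<or> b \<or> c \<longrightarrow> t\<^sub>1 = shift_pair D 1 t\<^sub>2)"
proof -
  interpret triangulated_category D by fact
  obtain T1 F1 T2 F2 where t: "t\<^sub>1 = (T1, F1)" "t\<^sub>2 = (T2, F2)" by (metis surj_pair)
  interpret torsion_interval D T1 F1 T2 F2
    by unfold_locales (use assms(2,3,7) in \<open>auto simp: t stors_le_def shift_pair_def shift_def\<close>)
  have C: "heart t\<^sub>1 t\<^sub>2 = C" by (simp add: heart_def t C_def)
  have inv: "inv_into (Obj D) (SO D) Y \<in> Obj D" "SO D (inv_into (Obj D) (SO D) Y) = Y"
    "inv_into (Obj D) (SO D) (SO D Y) = Y" if "Y \<in> Obj D" for Y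
    using that SO_bij by (auto simp: bij_betw_def inv_into_into f_inv_into_f)
  \<comment> \<open>Membership in the desuspension of \<open>T2\<close> is rewritten through the
    shift to match the form of \<open>X\<close>.\<close>
  have T: "Y \<in> fst t\<^sub>3 \<longleftrightarrow> SO D Y \<in> T2" if Y: "Y \<in> F1" for Y
  proof
    assume "Y \<in> fst t\<^sub>3"
    then obtain Z where "Z \<in> T2" "Y = inv_into (Obj D) (SO D) Z"
      by (auto simp: assms(8) t shift_pair_def shift_def)
    then show "SO D Y \<in> T2" using inv(2)[OF T2_Obj] by simp
  next
    assume "SO D Y \<in> T2"
    then have "inv_into (Obj D) (SO D) (SO D Y) \<in> fst t\<^sub>3"
      by (simp add: assms(8) t shift_pair_def shift_def)
    then show "Y \<in> fst t\<^sub>3" using inv(3)[OF F1_Obj[OF Y]] by simp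
  qed
  have "snd t\<^sub>1 = F1" by (simp add: t)
  then have X: "heart t\<^sub>1 t\<^sub>3 = X" using T unfolding heart_def X_def by blast
  have ac: "a \<Longrightarrow> c"
  proof (cases "zero_object D V")
    \<comment> \<open>\<open>nondegenerate\<close> makes the whole heart zero.\<close>
    case True
    then show c using zero_projective_generator[OF True] nondegenerate unfolding c_def X C by blast
  next
    case False
    assume a
    then show c using extended_tilting_projective_generator[OF _ False] unfolding a_def c_def X C by blast
  qed
  have cb: "c \<Longrightarrow> b"
    using projective_generator_extended_tilting[of V] unfolding b_def c_def X C by blast
  have ba: "b \<Longrightarrow> a" by (simp add: a_def b_def)
  have "c \<Longrightarrow> t\<^sub>1 = shift_pair D 1 t\<^sub>2"
    using projective_generator_t1[of V] unfolding c_def X C by (simp add: t shift_pair_def shift_def)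
  with ac cb ba show ?thesis by blast
qed

end
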